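(* Let $Y$ be a geodesic manifold and let $x,y\in Y$. (i) Every simple arc $A\in\Omega_Y(x,y)$ can be straightened to a minimal one, i.e. there is a minimal $C\in\Omega_Y(x,y)$ with $C\prec A$. (ii) A simple arc $A\in\Omega_Y(x,y)$ is minimal if and only if $A$ is a convex simple geodesic (between $x$ and $y$).
   Context: **Convexity space.** For a Hausdorff space $U$, the power set $\mathfrak P(U)$ carries the topology with basis the sets $\widetilde W=\{A\subset U : A\subset W\}$, $W$ open in $U$. A convexity space is a Hausdorff space $U$ with a continuous map $C\colon U\times U\to\mathfrak P(U)$ such that, calling $A\subset U$ convex if $C(x,y)\subset A$ for all $x,y\in A$: (C1) every $C(x,y)$ is convex; (C2) every $C(x,y)$ is minimal among the connected sets containing $x$ and $y$; (C3) $U$ has a basis of convex open sets. A convex subset of a convexity space is a convexity space with the restricted map. **Local convexity structure.** A local convexity structure (atlas) on a topological space $Y$ is an open covering $\mathfrak V$ of $Y$ by convexity spaces $V\in\mathfrak V$ (with the induced topology) such that every convex open subspace of each $V\in\mathfrak V$ belongs to $\mathfrak V$ (as a convexity space). $A\subset Y$ is convex if $A\cap V$ is convex in $V$ for all $V\in\mathfrak V$. The convex hull $C(A)$ of $A\subset Y$ is the smallest convex set containing $A$. **Étale maps.** For a continuous map $e\colon C\to Y$ with $C$ a connected topological space, $\mathfrak V_e$ is the set of all open $U\subset C$ which are mapped by $e$ homeomorphically onto a convex subspace of some $V\in\mathfrak V$. $e$ is étale if $e$ is a closed map and $\mathfrak V_e$ covers $C$. $e$ is generated by $F\subset C$ if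 there is no closed connected subspace $A\subsetneq C$ with $F\subset A$ such that $e(U\cap A)$ is convex (in the chart $V$ in which $e(U)$ is a convex subspace) for all $U\in\mathfrak V_e$. **Geodesic manifold.** A geodesic manifold is a Hausdorff space $Y$ with a local convexity structure $\mathfrak V$ such that: (G1) for every finite $F\subset Y$, the closure of $C(F)$ is compact; (G2) if an étale map $e\colon C\to Y$ with $C$ compact is generated by $\{x,y\}\subset C$, then every connected set $A\subset C$ with $x,y\in A$ equals $C$. **Geodesics.** A geodesic in $Y$ is an étale map $e\colon C\to Y$ with $C$ compact, generated by some $\{x,y\}\subset C$; $e(x),e(y)$ are its end points. It is simple if $e$ is the inclusion of a subspace $C\subset Y$, in which case it is identified with the subset $C$. **Arcs and straightening.** A linear continuum is a linearly ordered set that is connected in its order topology. A simple arc between $x,y\in Y$ is a subspace $A\subset Y$ which is a linear continuum with end points $x$ and $y$ (ordered so that $x$ is smallest). $\Omega_Y(x,y)$ is the set of all simple arcs between $x$ and $y$. For $A,B\in\Omega_Y(x,y)$, $A\prec B$ ("$A$ is a straightening of $B$") means $\overline{C(A)}\subset\overline{C(B)}$. $B\in\Omega_Y(x,y)$ is minimal if $A\prec B$ implies $B\prec A$ for all $A\in\Omega_Y(x,y)$. *)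

theory Defs
  imports "HOL-Analysis.Analysis"
begin

text \<open>The sets \<^term>\<open>Pow W\<close> are closed under finite intersections, so they form a basis of
  the topology they generate.\<close>

definition powerset_topology :: "'a topology \<Rightarrow> 'a set topology" where
  "powerset_topology X = topology_generated_by {Pow W | W. openin X W}"

definition convex_under :: "('a \<times> 'a \<Rightarrow> 'a set) \<Rightarrow> 'a set \<Rightarrow> bool" where
  "convex_under K A \<longleftrightarrow> (\<forall>x\<in>A. \<forall>y\<in>A. K (x, y) \<subseteq> A)"

definition convexity_space :: "'a topology \<Rightarrow> ('a \<times> 'a \<Rightarrow> 'a set) \<Rightarrow> bool" where
  "convexity_space X K \<longleftrightarrow>
     Hausdorff_space X \<and>
     continuous_map (prod_topology X X) (powerset_topology X) K \<and>
     (\<forall>x\<in>topspace X. \<forall>y\<in>topspace X. convex_under K (K (x, y))) \<and>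
     (\<forall>x\<in>topspace X. \<forall>y\<in>topspace X.
        connectedin X (K (x, y)) \<and> x \<in> K (x, y) \<and> y \<in> K (x, y) \<and>
        (\<forall>A. connectedin X A \<and> x \<in> A \<and> y \<in> A \<and> A \<subseteq> K (x, y) \<longrightarrow> A = K (x, y))) \<and>
     (\<forall>W x. openin X W \<and> x \<in> W \<longrightarrow>
        (\<exists>B. openin X B \<and> convex_under K B \<and> x \<in> B \<and> B \<subseteq> W))"

text \<open>A chart is a convexity space inside the ambient space: its underlying set together with its
  convexity map. The map is kept extensional, so that equality of pairs is equality of convexity
  spaces.\<close>

type_synonym 'a chart = "'a set \<times> ('a \<times> 'a \<Rightarrow> 'a set)"

definition local_convexity_structure :: "'a topology \<Rightarrow> 'a chart set \<Rightarrow> bool" where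
  "local_convexity_structure Y \<V> \<longleftrightarrow>
     (\<forall>(V, K)\<in>\<V>. openin Y V \<and> K \<in> extensional (V \<times> V) \<and>
        convexity_space (subtopology Y V) K) \<and>
     \<Union>(fst ` \<V>) = topspace Y \<and>
     (\<forall>(V, K)\<in>\<V>. \<forall>W. openin (subtopology Y V) W \<and> convex_under K W \<longrightarrow>
        (W, restrict K (W \<times> W)) \<in> \<V>)"

definition locally_convex_set :: "'a topology \<Rightarrow> 'a chart set \<Rightarrow> 'a set \<Rightarrow> bool" where
  "locally_convex_set Y \<V> A \<longleftrightarrow>
     A \<subseteq> topspace Y \<and> (\<forall>(V, K)\<in>\<V>. convex_under K (A \<inter> V))"

definition convex_hull_in :: "'a topology \<Rightarrow> 'a chart set \<Rightarrow> 'a set \<Rightarrow> 'a set" where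
  "convex_hull_in Y \<V> A = locally_convex_set Y \<V> hull A"

definition maps_onto_convex ::
  "'b topology \<Rightarrow> 'a topology \<Rightarrow> ('b \<Rightarrow> 'a) \<Rightarrow> 'b set \<Rightarrow> 'a chart \<Rightarrow> bool" where
  "maps_onto_convex T Y e U = (\<lambda>(V, K).
     e ` U \<subseteq> V \<and> convex_under K (e ` U) \<and>
     homeomorphic_map (subtopology T U) (subtopology Y (e ` U)) e)"

definition etale_charts ::
  "'b topology \<Rightarrow> 'a topology \<Rightarrow> 'a chart set \<Rightarrow> ('b \<Rightarrow> 'a) \<Rightarrow> 'b set set" where
  "etale_charts T Y \<V> e = {U. openin T U \<and> (\<exists>V\<in>\<V>. maps_onto_convex T Y e U V)}"

definition etale :: "'b topology \<Rightarrow> 'a topology \<Rightarrow> 'a chart set \<Rightarrow> ('b \<Rightarrow> 'a) \<Rightarrow> bool" where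
  "etale T Y \<V> e \<longleftrightarrow>
     connected_space T \<and> continuous_map T Y e \<and> closed_map T Y e \<and>
     \<Union>(etale_charts T Y \<V> e) = topspace T"

text \<open>A set \<open>e ` U\<close> may be a convex subspace of several charts; convexity of \<open>e ` (U \<inter> A)\<close> is
  required in each of them.\<close>

definition generated_by ::
  "'b topology \<Rightarrow> 'a topology \<Rightarrow> 'a chart set \<Rightarrow> ('b \<Rightarrow> 'a) \<Rightarrow> 'b set \<Rightarrow> bool" where
  "generated_by T Y \<V> e F \<longleftrightarrow>
     F \<subseteq> topspace T \<and>
     \<not> (\<exists>A. closedin T A \<and> connectedin T A \<and> A \<subset> topspace T \<and> F \<subseteq> A \<and>
          (\<forall>U\<in>etale_charts T Y \<V> e. \<forall>(V, K)\<in>\<V>.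
             maps_onto_convex T Y e U (V, K) \<longrightarrow> convex_under K (e ` (U \<inter> A))))"

text \<open>Compact means compact Hausdorff. Without the Hausdorff condition, doubling an inner point of a
  segment of the real line would give a geodesic containing its end points in a smaller connected
  set, and the real line would fail to be a geodesic manifold.\<close>

definition geodesic ::
  "'b topology \<Rightarrow> 'a topology \<Rightarrow> 'a chart set \<Rightarrow> ('b \<Rightarrow> 'a) \<Rightarrow> 'b \<Rightarrow> 'b \<Rightarrow> bool" where
  "geodesic T Y \<V> e p q \<longleftrightarrow>
     compact_space T \<and> Hausdorff_space T \<and> etale T Y \<V> e \<and> generated_by T Y \<V> e {p, q}"

text \<open>The second axiom ranges over all compact spaces \<open>T\<close>. It suffices to let \<open>T\<close> live on the type
  \<^typ>\<open>'a \<times> nat\<close>: finitely many etale charts \<open>U\<^sub>0, \<dots>, U\<^sub>n\<close> cover \<open>T\<close>, and \<open>e\<close> is injective on each,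
  so \<open>t \<mapsto> (e t, min {i. t \<in> U\<^sub>i})\<close> is injective. Lemma \<open>geodesic_manifold_G2\<close> below gives the axiom
  for spaces on an arbitrary type.\<close>

definition geodesic_manifold :: "'a topology \<Rightarrow> 'a chart set \<Rightarrow> bool" where
  "geodesic_manifold Y \<V> \<longleftrightarrow>
     Hausdorff_space Y \<and> local_convexity_structure Y \<V> \<and>
     (\<forall>F. finite F \<and> F \<subseteq> topspace Y \<longrightarrow> compactin Y (Y closure_of convex_hull_in Y \<V> F)) \<and>
     (\<forall>(T :: ('a \<times> nat) topology) e p q. geodesic T Y \<V> e p q \<longrightarrow>
        (\<forall>A. connectedin T A \<and> p \<in> A \<and> q \<in> A \<longrightarrow> A = topspace T))"

definition simple_geodesic :: "'a topology \<Rightarrow> 'a chart set \<Rightarrow> 'a \<Rightarrow> 'a \<Rightarrow> 'a set \<Rightarrow> bool" where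
  "simple_geodesic Y \<V> x y A \<longleftrightarrow>
     A \<subseteq> topspace Y \<and> geodesic (subtopology Y A) Y \<V> (\<lambda>z. z) x y"

definition order_topology_on :: "'a set \<Rightarrow> 'a rel \<Rightarrow> 'a topology" where
  "order_topology_on A r = topology_generated_by
     ({A} \<union> {{z\<in>A. (z, a) \<in> r - Id} | a. a \<in> A} \<union> {{z\<in>A. (a, z) \<in> r - Id} | a. a \<in> A})"

definition linear_continuum_on :: "'a set \<Rightarrow> 'a rel \<Rightarrow> bool" where
  "linear_continuum_on A r \<longleftrightarrow> linear_order_on A r \<and> connected_space (order_topology_on A r)"

definition simple_arcs :: "'a topology \<Rightarrow> 'a \<Rightarrow> 'a \<Rightarrow> 'a set set" where
  "simple_arcs Y x y = {A. A \<subseteq> topspace Y \<and> x \<in> A \<and> y \<in> A \<and>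
     (\<exists>r. linear_continuum_on A r \<and> subtopology Y A = order_topology_on A r \<and>
          (\<forall>z\<in>A. (x, z) \<in> r \<and> (z, y) \<in> r))}"

definition straightening :: "'a topology \<Rightarrow> 'a chart set \<Rightarrow> 'a set \<Rightarrow> 'a set \<Rightarrow> bool" where
  "straightening Y \<V> A B \<longleftrightarrow>
     Y closure_of convex_hull_in Y \<V> A \<subseteq> Y closure_of convex_hull_in Y \<V> B"

definition minimal_arc :: "'a topology \<Rightarrow> 'a chart set \<Rightarrow> 'a \<Rightarrow> 'a \<Rightarrow> 'a set \<Rightarrow> bool" where
  "minimal_arc Y \<V> x y B \<longleftrightarrow>
     B \<in> simple_arcs Y x y \<and>
     (\<forall>A\<in>simple_arcs Y x y. straightening Y \<V> A B \<longrightarrow> straightening Y \<V> B A)"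

lemma homeomorphic_copy:
  assumes "inj_on f (topspace T)"
  obtains T' where "homeomorphic_map T T' f"
proof
  define g where "g = inv_into (topspace T) f"
  define T' where "T' = pullback_topology (f ` topspace T) g T"
  have gf: "g (f t) = t" if "t \<in> topspace T" for t
    using assms that by (simp add: g_def)
  have top: "topspace T' = f ` topspace T"
    by (auto simp: T'_def topspace_pullback_topology gf)
  have "continuous_map T T' f"
    unfolding T'_def
  proof (rule continuous_map_pullback')
    show "continuous_map T T (g \<circ> f)"
      by (rule continuous_map_eq[OF continuous_map_id]) (auto simp: gf)
  qed auto
  moreover have "continuous_map T' T (id \<circ> g)"
    unfolding T'_def by (rule continuous_map_pullback) (rule continuous_map_id)
  ultimately have "homeomorphic_maps T T' f g"
    by (auto simp: homeomorphic_maps_def top gf)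
  then show "homeomorphic_map T T' f"
    by (rule homeomorphic_maps_map[THEN iffD1, THEN conjunct1])
qed

lemma maps_onto_convex_homeomorphic:
  assumes h: "homeomorphic_map T T' f" and e: "\<And>t. t \<in> topspace T \<Longrightarrow> e' (f t) = e t"
    and U: "U \<subseteq> topspace T"
  shows "maps_onto_convex T' Y e' (f ` U) c \<longleftrightarrow> maps_onto_convex T Y e U c"
proof -
  have im: "e' ` f ` U = e ` U"
    using e U by (force simp: image_iff)
  have fU: "f ` (topspace T \<inter> U) = topspace T' \<inter> f ` U"
    using U h homeomorphic_imp_surjective_map by fastforce
  have hU: "homeomorphic_map (subtopology T U) (subtopology T' (f ` U)) f"
    by (rule homeomorphic_map_subtopologies[OF h fU])
  have "homeomorphic_map (subtopology T' (f ` U)) (subtopology Y (e ` U)) e' \<longleftrightarrow>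
        homeomorphic_map (subtopology T U) (subtopology Y (e ` U)) e" (is "?L \<longleftrightarrow> ?R")
  proof
    assume ?L
    then have "homeomorphic_map (subtopology T U) (subtopology Y (e ` U)) (e' \<circ> f)"
      by (rule homeomorphic_map_compose[OF hU])
    then show ?R
      by (rule homeomorphic_map_eq) (auto simp: e)
  next
    assume R: ?R
    obtain g where g: "homeomorphic_maps (subtopology T U) (subtopology T' (f ` U)) f g"
      using hU homeomorphic_map_maps by blast
    then have "homeomorphic_map (subtopology T' (f ` U)) (subtopology T U) g"
      using homeomorphic_maps_map by blast
    then have "homeomorphic_map (subtopology T' (f ` U)) (subtopology Y (e ` U)) (e \<circ> g)"
      using R by (rule homeomorphic_map_compose)
    then show ?L
      by (rule homeomorphic_map_eq) (use g U e in \<open>auto simp: homeomorphic_maps_def\<close>)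
  qed
  then show ?thesis
    unfolding maps_onto_convex_def im by (auto split: prod.splits)
qed

lemma geodesic_homeomorphic:
  assumes h: "homeomorphic_map T T' f" and e: "\<And>t. t \<in> topspace T \<Longrightarrow> e' (f t) = e t"
    and geo: "geodesic T Y \<V> e p q"
  shows "geodesic T' Y \<V> e' (f p) (f q)"
proof -
  have surj: "f ` topspace T = topspace T'" and inj: "inj_on f (topspace T)"
    using h homeomorphic_imp_surjective_map homeomorphic_imp_injective_map by blast+
  have pull: "\<exists>B\<subseteq>topspace T. A = f ` B" if "A \<subseteq> topspace T'" for A
    using that surj by (metis subset_imageE)
  have im: "e' ` f ` U = e ` U" if "U \<subseteq> topspace T" for U
    using e that by (force simp: image_iff)
  have charts: "f ` U \<in> etale_charts T' Y \<V> e' \<longleftrightarrow> U \<in> etale_charts T Y \<V> e"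
    if "U \<subseteq> topspace T" for U
    using that h e
    by (simp add: etale_charts_def homeomorphic_map_openness maps_onto_convex_homeomorphic)
  have sub: "U \<subseteq> topspace T" if "U \<in> etale_charts T Y \<V> e" for U
    using that openin_subset by (auto simp: etale_charts_def)
  have et: "etale T Y \<V> e" and gen: "generated_by T Y \<V> e {p, q}"
    and cpt: "compact_space T" and hd: "Hausdorff_space T"
    using geo by (auto simp: geodesic_def)
  have hs: "T homeomorphic_space T'"
    using h homeomorphic_map_imp_homeomorphic_space by blast
  obtain g where g: "homeomorphic_maps T T' f g"
    using h homeomorphic_map_maps by blast
  have "continuous_map T' Y (e \<circ> g)"
    using g et by (meson continuous_map_compose etale_def homeomorphic_maps_def)
  then have cont: "continuous_map T' Y e'"
  proof (rule continuous_map_eq)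
    fix s assume "s \<in> topspace T'"
    then obtain t where t: "t \<in> topspace T" "s = f t"
      using surj by blast
    then have "g s = t"
      using g by (auto simp: homeomorphic_maps_def)
    then show "(e \<circ> g) s = e' s"
      using t e by simp
  qed
  have closed: "closed_map T' Y e'"
    unfolding closed_map_def
  proof (intro allI impI)
    fix A assume A: "closedin T' A"
    then obtain B where B: "B \<subseteq> topspace T" "A = f ` B"
      using pull closedin_subset by metis
    then have "closedin T B"
      using A h homeomorphic_map_closedness by metis
    then show "closedin Y (e' ` A)"
      using et B im by (simp add: etale_def closed_map_def)
  qed
  have cover: "\<Union>(etale_charts T' Y \<V> e') = topspace T'"
  proof
    show "\<Union>(etale_charts T' Y \<V> e') \<subseteq> topspace T'"
      using openin_subset by (auto simp: etale_charts_def)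
    show "topspace T' \<subseteq> \<Union>(etale_charts T' Y \<V> e')"
    proof
      fix s assume "s \<in> topspace T'"
      then obtain t where t: "t \<in> topspace T" "s = f t"
        using surj by blast
      then obtain U where U: "U \<in> etale_charts T Y \<V> e" "t \<in> U"
        using et by (auto simp: etale_def)
      then show "s \<in> \<Union>(etale_charts T' Y \<V> e')"
        using t charts[OF sub[OF U(1)]] by blast
    qed
  qed
  have conn: "connected_space T'"
    using et hs homeomorphic_connected_space by (auto simp: etale_def)
  have "generated_by T' Y \<V> e' {f p, f q}"
    unfolding generated_by_def
  proof (intro conjI notI)
    show "{f p, f q} \<subseteq> topspace T'"
      using gen surj by (auto simp: generated_by_def)
    assume "\<exists>A. closedin T' A \<and> connectedin T' A \<and> A \<subset> topspace T' \<and> {f p, f q} \<subseteq> A \<and>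
          (\<forall>U\<in>etale_charts T' Y \<V> e'. \<forall>(V, K)\<in>\<V>.
             maps_onto_convex T' Y e' U (V, K) \<longrightarrow> convex_under K (e' ` (U \<inter> A)))"
    then obtain A where A: "closedin T' A" "connectedin T' A" "A \<subset> topspace T'" "{f p, f q} \<subseteq> A"
      and cv': "\<forall>U\<in>etale_charts T' Y \<V> e'. \<forall>(V, K)\<in>\<V>.
             maps_onto_convex T' Y e' U (V, K) \<longrightarrow> convex_under K (e' ` (U \<inter> A))"
      by (elim exE conjE)
    have cv: "convex_under K (e' ` (U \<inter> A))" if "U \<in> etale_charts T' Y \<V> e'" "(V, K) \<in> \<V>"
        "maps_onto_convex T' Y e' U (V, K)" for U V K
      using bspec[OF bspec[OF cv' that(1)] that(2)] that(3) by simp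
    obtain B where B: "B \<subseteq> topspace T" "A = f ` B"
      using pull A(3) by blast
    have 1: "closedin T B"
      using A(1) B h homeomorphic_map_closedness by metis
    have 2: "connectedin T B"
      using A(2) B h homeomorphic_map_connectedness by metis
    have 3: "B \<subset> topspace T"
      using A(3) B surj by blast
    have 4: "{p, q} \<subseteq> B"
      using A(4) B inj gen by (auto simp: generated_by_def inj_on_image_mem_iff)
    have 5: "convex_under K (e ` (U \<inter> B))"
      if U: "U \<in> etale_charts T Y \<V> e" and "(V, K) \<in> \<V>" "maps_onto_convex T Y e U (V, K)" for U V K
    proof -
      have "convex_under K (e' ` (f ` U \<inter> A))"
      proof (rule cv)
        show "f ` U \<in> etale_charts T' Y \<V> e'"
          using U charts[OF sub[OF U]] by simp
        show "(V, K) \<in> \<V>"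
          by fact
        show "maps_onto_convex T' Y e' (f ` U) (V, K)"
          using that(3) maps_onto_convex_homeomorphic[where e = e and e' = e', OF h e sub[OF U]]
          by simp
      qed
      moreover have "f ` U \<inter> A = f ` (U \<inter> B)"
        using B sub[OF U] inj by (simp add: inj_on_image_Int)
      ultimately show ?thesis
        using im[of "U \<inter> B"] B by (simp add: le_infI2)
    qed
    have "\<forall>U\<in>etale_charts T Y \<V> e. \<forall>(V, K)\<in>\<V>.
             maps_onto_convex T Y e U (V, K) \<longrightarrow> convex_under K (e ` (U \<inter> B))"
      using 5 by auto
    with 1 2 3 4 have "\<exists>A. closedin T A \<and> connectedin T A \<and> A \<subset> topspace T \<and> {p, q} \<subseteq> A \<and>
          (\<forall>U\<in>etale_charts T Y \<V> e. \<forall>(V, K)\<in>\<V>.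
             maps_onto_convex T Y e U (V, K) \<longrightarrow> convex_under K (e ` (U \<inter> A)))"
      by (intro exI conjI)
    then show False
      using gen[unfolded generated_by_def, THEN conjunct2] by (rule notE[rotated])
  qed
  then show ?thesis
    using cpt hd conn cont closed cover
      homeomorphic_compact_space[OF hs] homeomorphic_Hausdorff_space[OF hs]
    by (simp add: geodesic_def etale_def)
qed

lemma geodesic_manifold_G2:
  fixes T :: "'b topology" and Y :: "'a topology"
  assumes Y: "geodesic_manifold Y \<V>" and geo: "geodesic T Y \<V> e p q"
    and A: "connectedin T A" "p \<in> A" "q \<in> A"
  shows "A = topspace T"
proof -
  have et: "etale T Y \<V> e" and cpt: "compact_space T"
    using geo by (auto simp: geodesic_def)
  have op: "openin T U" and inj: "inj_on e U" if "U \<in> etale_charts T Y \<V> e" for U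
  proof -
    show "openin T U"
      using that by (simp add: etale_charts_def)
    then have "topspace T \<inter> U = U"
      using openin_subset by blast
    then show "inj_on e U"
      using that homeomorphic_imp_injective_map
      by (fastforce simp: etale_charts_def maps_onto_convex_def)
  qed
  obtain \<U> where \<U>: "finite \<U>" "\<U> \<subseteq> etale_charts T Y \<V> e" "topspace T \<subseteq> \<Union>\<U>"
    using cpt op et unfolding compact_space_alt etale_def by (metis order_refl)
  obtain n :: "'b set \<Rightarrow> nat" where n: "inj_on n \<U>"
    using \<U>(1) finite_imp_inj_to_nat_seg by metis
  define c where "c t = (SOME U. U \<in> \<U> \<and> t \<in> U)" for t
  have c: "c t \<in> \<U>" "t \<in> c t" if "t \<in> topspace T" for t
    using someI_ex[of "\<lambda>U. U \<in> \<U> \<and> t \<in> U"] \<U>(3) that by (auto simp: c_def)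
  define f where "f t = (e t, n (c t))" for t
  have "inj_on f (topspace T)"
  proof (rule inj_onI)
    fix s t assume st: "s \<in> topspace T" "t \<in> topspace T" "f s = f t"
    then have "c s = c t"
      using n c by (auto simp: f_def dest: inj_onD)
    then show "s = t"
      using st c \<U>(2) inj by (metis f_def inj_onD prod.inject subsetD)
  qed
  then obtain T' where T': "homeomorphic_map T T' f"
    by (rule homeomorphic_copy)
  have G2: "B = topspace T'" if "geodesic T' Y \<V> fst r s" "connectedin T' B" "r \<in> B" "s \<in> B" for r s B
    using Y that unfolding geodesic_manifold_def by metis
  have "geodesic T' Y \<V> fst (f p) (f q)"
    by (rule geodesic_homeomorphic[OF T' _ geo]) (simp add: f_def)
  moreover have "connectedin T' (f ` A)"
    using A T' connectedin_subset_topspace homeomorphic_map_connectedness by metis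
  ultimately have "f ` A = topspace T'"
    using G2 A by blast
  then show ?thesis
    using T' A connectedin_subset_topspace[OF A(1)]
    by (metis homeomorphic_imp_injective_map homeomorphic_imp_surjective_map
        inj_on_image_eq_iff order_refl)
qed

end

theory Submission
  imports Defs
begin

text \<open>A simple arc \<open>A\<close> can be replaced, inside its convex hull, by a connected union of finitely many
  segments, hence by a connected subset of \<open>C(F)\<close> for a finite \<open>F \<subseteq> A\<close>. The closure \<open>D\<close> of \<open>C(F)\<close>
  is compact by (G1) and again convex, because minimality of segments makes them compact arcs that vary
  lower semicontinuously. Connected components of convex sets are convex, and intersections of chains
  of continua are continua, so Zorn's lemma gives a minimal convex continuum \<open>C \<subseteq> D\<close> through the end
  points. Its inclusion is a geodesic, and by (G2) no proper connected subset of \<open>C\<close> contains both end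
  points. Ordering \<open>C\<close> by its cut points shows that it is a simple arc; being closed and convex it
  equals its closed convex hull, so every straightening of it lies in \<open>C\<close> and thus is \<open>C\<close>.\<close>

section \<open>Connected spaces irreducible between two points\<close>

text \<open>A clopen argument in local form: a neighbourhood \<open>B\<close> of a point outside
  \<open>S\<close> that met \<open>S\<close> would lie in \<open>S\<close> together with the point.
  It serves twice below to propagate a property through a connected space.\<close>

lemma connected_space_induct:
  assumes X: "connected_space X" and S: "S \<subseteq> topspace X" "S \<noteq> {}"
    and step: "\<And>a. a \<in> topspace X \<Longrightarrow> \<exists>B. openin X B \<and> a \<in> B \<and> (S \<inter> B \<noteq> {} \<longrightarrow> B \<subseteq> S)"
  shows "S = topspace X"
proof -
  have "\<exists>B. openin X B \<and> a \<in> B \<and> B \<subseteq> S" if "a \<in> S" for a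
    using step[of a] S(1) that by blast
  then have "openin X S"
    using openin_subopen[of X S] by blast
  moreover have "\<exists>B. openin X B \<and> a \<in> B \<and> B \<subseteq> topspace X - S" if a: "a \<in> topspace X - S" for a
  proof -
    obtain B where B: "openin X B" "a \<in> B" "S \<inter> B \<noteq> {} \<longrightarrow> B \<subseteq> S"
      using step[of a] a by blast
    then have "B \<subseteq> topspace X - S"
      using a openin_subset[OF B(1)] by blast
    then show ?thesis
      using B by blast
  qed
  then have "openin X (topspace X - S)"
    using openin_subopen[of X "topspace X - S"] by blast
  ultimately show ?thesis
    using X S by (metis closedin_def connected_space_clopen_in)
qed

text \<open>The notion from continuum theory, but without compactness, so that it applies to
  segments before they are known to be compact.\<close>

definition irreducible_between :: "'a topology \<Rightarrow> 'a \<Rightarrow> 'a \<Rightarrow> bool" where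
  "irreducible_between X p q \<longleftrightarrow>
     connected_space X \<and> p \<in> topspace X \<and> q \<in> topspace X \<and>
     (\<forall>A. connectedin X A \<and> p \<in> A \<and> q \<in> A \<longrightarrow> A = topspace X)"

lemma connectedin_insert_cut_point:
  assumes X: "connected_space X" and z: "z \<in> topspace X"
    and L: "openin X L" and R: "openin X R" and LR: "L \<inter> R = {}" "L \<union> R = topspace X - {z}"
  shows "connectedin X (insert z L)"
proof -
  have eqs: "insert z L = topspace X - R" "insert z R = topspace X - L"
    using z LR openin_subset[OF L] openin_subset[OF R] by blast+
  have cl: "closedin X (insert z L)" "closedin X (insert z R)"
    unfolding eqs using L R by blast+
  \<comment> \<open>The part containing \<open>z\<close> can absorb all of
    \<open>insert z R\<close>, which turns a separation of \<open>insert z L\<close> into one of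
    \<open>X\<close>. The two parts play symmetric roles, so it is enough to treat
    \<open>z \<in> E1\<close>.\<close>
  have split: False
    if E: "closedin X E1" "closedin X E2" "insert z L \<subseteq> E1 \<union> E2" "E1 \<inter> E2 \<inter> insert z L = {}"
      "E2 \<inter> insert z L \<noteq> {}" "z \<in> E1" for E1 E2
  proof -
    let ?A = "E1 \<inter> insert z L \<union> insert z R" and ?B = "E2 \<inter> insert z L"
    have "closedin X ?A" "closedin X ?B"
      using E cl by blast+
    moreover have "?A \<union> ?B = topspace X"
      using E(3) LR z by auto
    moreover have "?A \<inter> ?B = {}"
      using E(4,6) LR by auto
    ultimately show False
      using X E(5) unfolding connected_space_closedin_eq by blast
  qed
  show ?thesis
    unfolding connectedin_closedin
  proof (intro conjI notI)
    show "insert z L \<subseteq> topspace X"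
      using cl closedin_subset by blast
    assume "\<exists>E1 E2. closedin X E1 \<and> closedin X E2 \<and> insert z L \<subseteq> E1 \<union> E2 \<and>
      E1 \<inter> E2 \<inter> insert z L = {} \<and> E1 \<inter> insert z L \<noteq> {} \<and> E2 \<inter> insert z L \<noteq> {}"
    then obtain E1 E2 where E: "closedin X E1" "closedin X E2" "insert z L \<subseteq> E1 \<union> E2"
      "E1 \<inter> E2 \<inter> insert z L = {}" "E1 \<inter> insert z L \<noteq> {}" "E2 \<inter> insert z L \<noteq> {}"
      by blast
    show False
    proof (cases "z \<in> E1")
      case True
      with split[of E1 E2] E show False by blast
    next
      case False
      with E(3) have "z \<in> E2" by blast
      with split[of E2 E1] E show False by blast
    qed
  qed
qed

text \<open>A point \<open>z\<close> other than \<open>p\<close> and \<open>q\<close> must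
  disconnect the space, since its complement contains both end points. These lie on different sides:
  if both were in \<open>L\<close>, then \<open>insert z L\<close> would be a connected set
  containing them and missing the nonempty \<open>R\<close>.\<close>

lemma irreducible_between_cut:
  assumes T1: "t1_space X" and irr: "irreducible_between X p q" and z: "z \<in> topspace X"
  shows "\<exists>L R. openin X L \<and> openin X R \<and> L \<inter> R = {} \<and> L \<union> R = topspace X - {z} \<and>
    connectedin X (insert z L) \<and> connectedin X (insert z R) \<and> p \<in> insert z L \<and> q \<in> insert z R"
proof -
  have X: "connected_space X" and pq: "p \<in> topspace X" "q \<in> topspace X"
    and min: "\<And>A. connectedin X A \<Longrightarrow> p \<in> A \<Longrightarrow> q \<in> A \<Longrightarrow> A = topspace X"
    using irr by (auto simp: irreducible_between_def)
  have op: "openin X (topspace X - {z})"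
    using T1 z by (simp add: closedin_t1_singleton openin_diff)
  have whole: "connectedin X (insert z (topspace X - {z}))"
    using X z by (simp add: insert_absorb connectedin_topspace)
  consider "z = p" | "z = q" | "z \<noteq> p" "z \<noteq> q" by blast
  then show ?thesis
  proof cases
    \<comment> \<open>At an end point one side is empty: \<open>L\<close> if \<open>z = p\<close>,
      and \<open>R\<close> if \<open>z = q\<close>.\<close>
    case 1
    then show ?thesis
      using op whole z pq by (intro exI[of _ "{}"] exI[of _ "topspace X - {z}"]) auto
  next
    case 2
    then show ?thesis
      using op whole z pq by (intro exI[of _ "{}"] exI[of _ "topspace X - {z}"]) auto
  next
    case 3
    then have "\<not> connectedin X (topspace X - {z})"
      using min pq z by blast
    then have "\<not> connected_space (subtopology X (topspace X - {z}))"
      by (simp add: connectedin_def)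
    then obtain L R where LR: "openin X L" "openin X R" "L \<inter> R = {}" "L \<union> R = topspace X - {z}"
      "L \<noteq> {}" "R \<noteq> {}"
      using op unfolding connected_space_eq
      by (auto simp: openin_open_subtopology Int_absorb1)
    have conn: "connectedin X (insert z L)" "connectedin X (insert z R)"
      using connectedin_insert_cut_point[OF X z] LR by (metis inf_commute sup_commute)+
    show ?thesis
    proof (cases "p \<in> L")
      case True
      then have "q \<notin> L"
        using min[OF conn(1)] LR z by blast
      then have "q \<in> R"
        using LR(4) pq 3 by blast
      then show ?thesis
        using True LR conn by (intro exI[of _ L] exI[of _ R]) simp
    next
      case False
      then have p: "p \<in> R"
        using LR pq 3 by blast
      then have "q \<notin> R"
        using min[OF conn(2)] LR z by blast
      then have "q \<in> L"
        using LR(4) pq 3 by blast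
      then show ?thesis
        using p LR conn by (intro exI[of _ R] exI[of _ L]) (simp add: Int_commute Un_commute)
    qed
  qed
qed

text \<open>\<open>L z\<close> and \<open>R z\<close> are the strict predecessors and successors of
  \<open>z\<close> in the cut point order from \<open>p\<close> to \<open>q\<close>. The sides are
  chosen separately for each \<open>z\<close>; they fit together because a connected set that misses
  \<open>a\<close> lies on one side of \<open>a\<close>.\<close>

lemma irreducible_between_order:
  assumes T1: "t1_space X" and irr: "irreducible_between X p q"
  obtains L R where
    "\<And>z. z \<in> topspace X \<Longrightarrow> openin X (L z)" "\<And>z. z \<in> topspace X \<Longrightarrow> openin X (R z)"
    "\<And>z. z \<in> topspace X \<Longrightarrow> L z \<inter> R z = {}"
    "\<And>z. z \<in> topspace X \<Longrightarrow> L z \<union> R z = topspace X - {z}"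
    "\<And>z. z \<in> topspace X \<Longrightarrow> p \<in> insert z (L z)" "\<And>z. z \<in> topspace X \<Longrightarrow> q \<in> insert z (R z)"
    "\<And>a b. a \<in> topspace X \<Longrightarrow> b \<in> topspace X \<Longrightarrow> a \<in> L b \<longleftrightarrow> b \<in> R a"
    "\<And>a b. b \<in> topspace X \<Longrightarrow> a \<in> L b \<Longrightarrow> L a \<subseteq> L b"
proof -
  obtain L R where LR: "\<And>z. z \<in> topspace X \<Longrightarrow>
    openin X (L z) \<and> openin X (R z) \<and> L z \<inter> R z = {} \<and> L z \<union> R z = topspace X - {z} \<and>
    connectedin X (insert z (L z)) \<and> connectedin X (insert z (R z)) \<and>
    p \<in> insert z (L z) \<and> q \<in> insert z (R z)"
    using irreducible_between_cut[OF T1 irr] by metis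
  have side: "D \<subseteq> L a \<or> D \<subseteq> R a" if "connectedin X D" "a \<in> topspace X" "a \<notin> D" for D a
  proof -
    have D: "D \<subseteq> L a \<union> R a"
      using that LR[OF that(2)] connectedin_subset_topspace by blast
    then have "L a \<inter> D = {} \<or> R a \<inter> D = {}"
      using connectedinD[OF that(1), of "L a" "R a"] LR[OF that(2)] by blast
    then show ?thesis
      using D by blast
  qed
  \<comment> \<open>The connected set \<open>insert b (R b)\<close> misses \<open>a\<close> and
    contains \<open>q\<close>, which is not in \<open>L a\<close>; so it lies on the side
    \<open>R a\<close>. Dually, \<open>p\<close> decides the side in \<open>below\<close>.\<close>
  have above: "insert b (R b) \<subseteq> R a" if "b \<in> topspace X" "a \<in> L b" for a b
  proof -
    have a: "a \<in> topspace X" "a \<notin> insert b (R b)"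
      using that LR[OF that(1)] by blast+
    then have "\<not> insert b (R b) \<subseteq> L a"
      using LR[OF a(1)] LR[OF that(1)] by blast
    then show ?thesis
      using side[OF _ a] LR[OF that(1)] by blast
  qed
  have below: "insert b (L b) \<subseteq> L a" if "b \<in> topspace X" "a \<in> R b" for a b
  proof -
    have a: "a \<in> topspace X" "a \<notin> insert b (L b)"
      using that LR[OF that(1)] by blast+
    then have "\<not> insert b (L b) \<subseteq> R a"
      using LR[OF a(1)] LR[OF that(1)] by blast
    then show ?thesis
      using side[OF _ a] LR[OF that(1)] by blast
  qed
  have eq: "a \<in> L b \<longleftrightarrow> b \<in> R a" if "a \<in> topspace X" "b \<in> topspace X" for a b
    using above below that by blast
  have mono: "L a \<subseteq> L b" if "b \<in> topspace X" "a \<in> L b" for a b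
  proof -
    have "a \<in> topspace X"
      using that LR by blast
    then show ?thesis
      using below eq that by blast
  qed
  show thesis
  proof (rule that[of L R])
    fix z assume "z \<in> topspace X"
    from LR[OF this]
    show "openin X (L z)" "openin X (R z)" "L z \<inter> R z = {}" "L z \<union> R z = topspace X - {z}"
      "p \<in> insert z (L z)" "q \<in> insert z (R z)"
      by auto
  qed (use eq mono in auto)
qed

text \<open>The Heine-Borel argument along the cut point order: the points whose closed initial
  segment has a finite subcover form a set that contains \<open>p\<close> and is clopen, hence
  contains \<open>q\<close>. Local connectedness supplies connected neighbourhoods inside members of
  the cover.\<close>

lemma compact_space_irreducible_between:
  assumes T1: "t1_space X" and irr: "irreducible_between X p q" and lc: "locally_connected_space X"
  shows "compact_space X"
  unfolding compact_space_alt
proof (intro allI impI)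
  fix \<U> assume \<U>: "(\<forall>U\<in>\<U>. openin X U) \<and> topspace X \<subseteq> \<Union>\<U>"
  have X: "connected_space X" and pq: "p \<in> topspace X" "q \<in> topspace X"
    using irr by (auto simp: irreducible_between_def)
  obtain L R where LR:
    "\<And>z. z \<in> topspace X \<Longrightarrow> openin X (L z)" "\<And>z. z \<in> topspace X \<Longrightarrow> openin X (R z)"
    "\<And>z. z \<in> topspace X \<Longrightarrow> L z \<inter> R z = {}"
    "\<And>z. z \<in> topspace X \<Longrightarrow> L z \<union> R z = topspace X - {z}"
    "\<And>z. z \<in> topspace X \<Longrightarrow> p \<in> insert z (L z)" "\<And>z. z \<in> topspace X \<Longrightarrow> q \<in> insert z (R z)"
    "\<And>a b. a \<in> topspace X \<Longrightarrow> b \<in> topspace X \<Longrightarrow> a \<in> L b \<longleftrightarrow> b \<in> R a"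
    "\<And>a b. b \<in> topspace X \<Longrightarrow> a \<in> L b \<Longrightarrow> L a \<subseteq> L b"
    using irreducible_between_order[OF T1 irr] by blast
  define S where
    "S = {a \<in> topspace X. \<exists>\<F>. finite \<F> \<and> \<F> \<subseteq> \<U> \<and> insert a (L a) \<subseteq> \<Union>\<F>}"
  have "S = topspace X"
  proof (rule connected_space_induct[OF X])
    show "S \<subseteq> topspace X"
      by (auto simp: S_def)
    have "L p = {}"
    proof (rule equals0I)
      fix c assume c: "c \<in> L p"
      then have "c \<in> topspace X" "c \<noteq> p"
        using LR(4)[OF pq(1)] by blast+
      then show False
        using c LR(3,5)[of c] LR(7)[OF _ pq(1), of c] by blast
    qed
    moreover obtain U where "U \<in> \<U>" "p \<in> U"
      using \<U> pq by blast
    ultimately have "p \<in> S"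
      using pq by (auto simp: S_def intro!: exI[of _ "{U}"])
    then show "S \<noteq> {}"
      by blast
    fix a assume a: "a \<in> topspace X"
    obtain U where U: "U \<in> \<U>" "a \<in> U"
      using \<U> a by blast
    then obtain B where B: "openin X B" "connectedin X B" "a \<in> B" "B \<subseteq> U"
      using lc \<U> unfolding locally_connected_space by metis
    have "b \<in> S" if s: "s \<in> S" "s \<in> B" and b: "b \<in> B" for s b
    proof -
      obtain \<F> where \<F>: "finite \<F>" "\<F> \<subseteq> \<U>" "insert s (L s) \<subseteq> \<Union>\<F>" and sX: "s \<in> topspace X"
        using s by (auto simp: S_def)
      have bX: "b \<in> topspace X"
        using b B openin_subset by blast
      have "c \<in> \<Union>(insert U \<F>)" if c: "c \<in> insert b (L b)" for c
      proof (rule ccontr)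
        \<comment> \<open>An uncovered \<open>c\<close> lies strictly between \<open>s\<close> and
          \<open>b\<close> and outside \<open>B\<close>, so \<open>L c\<close> and
          \<open>R c\<close> would split the connected set \<open>B\<close>.\<close>
        assume "c \<notin> \<Union>(insert U \<F>)"
        then have nc: "c \<notin> B" "c \<noteq> s" "c \<notin> L s"
          using B \<F> by auto
        have cX: "c \<in> topspace X"
          using c bX LR(4) by blast
        have "c \<in> L b"
          using c nc b by blast
        then have "b \<in> R c"
          using LR(7) cX bX by blast
        moreover have "s \<in> L c"
          using nc LR(4)[OF sX] LR(7)[OF sX cX] cX by blast
        moreover have "B \<subseteq> L c \<union> R c"
          using LR(4)[OF cX] nc B openin_subset by blast
        ultimately show False
          using connectedinD[OF B(2) LR(1)[OF cX] LR(2)[OF cX]] LR(3)[OF cX] s b by blast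
      qed
      then have "insert b (L b) \<subseteq> \<Union>(insert U \<F>)"
        by blast
      then show ?thesis
        using \<F> U bX unfolding S_def by (blast intro: finite.insertI)
    qed
    then show "\<exists>B. openin X B \<and> a \<in> B \<and> (S \<inter> B \<noteq> {} \<longrightarrow> B \<subseteq> S)"
      using B by blast
  qed
  then have "q \<in> S"
    using pq by simp
  then obtain \<F> where \<F>: "finite \<F>" "\<F> \<subseteq> \<U>" "insert q (L q) \<subseteq> \<Union>\<F>"
    unfolding S_def by blast
  have "R q = {}"
  proof (rule equals0I)
    fix c assume c: "c \<in> R q"
    then have "c \<in> topspace X" "c \<noteq> q"
      using LR(4)[OF pq(2)] by blast+
    then show False
      using c LR(3,6)[of c] LR(7)[OF pq(2), of c] by blast
  qed
  then have "topspace X \<subseteq> insert q (L q)"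
    using LR(4)[OF pq(2)] by blast
  then have "topspace X \<subseteq> \<Union>\<F>"
    using \<F>(3) by (rule subset_trans)
  then show "\<exists>\<F>. finite \<F> \<and> \<F> \<subseteq> \<U> \<and> topspace X \<subseteq> \<Union>\<F>"
    using \<F>(1,2) by (intro exI[of _ \<F>] conjI)
qed

text \<open>The rays of the cut point order are open in \<open>X\<close>, so the order topology is
  coarser than that of \<open>X\<close>. It is also Hausdorff, and a continuous bijection from a
  compact space to a Hausdorff space is a homeomorphism; applied to the identity, this makes the
  topologies equal.\<close>

lemma linear_continuum_irreducible_between:
  assumes cpt: "compact_space X" and H: "Hausdorff_space X" and irr: "irreducible_between X p q"
  shows "\<exists>r. linear_continuum_on (topspace X) r \<and> X = order_topology_on (topspace X) r \<and>
    (\<forall>z\<in>topspace X. (p, z) \<in> r \<and> (z, q) \<in> r)"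
proof -
  have X: "connected_space X" and pq: "p \<in> topspace X" "q \<in> topspace X"
    using irr by (auto simp: irreducible_between_def)
  obtain L R where LR:
    "\<And>z. z \<in> topspace X \<Longrightarrow> openin X (L z)" "\<And>z. z \<in> topspace X \<Longrightarrow> openin X (R z)"
    "\<And>z. z \<in> topspace X \<Longrightarrow> L z \<inter> R z = {}"
    "\<And>z. z \<in> topspace X \<Longrightarrow> L z \<union> R z = topspace X - {z}"
    "\<And>z. z \<in> topspace X \<Longrightarrow> p \<in> insert z (L z)" "\<And>z. z \<in> topspace X \<Longrightarrow> q \<in> insert z (R z)"
    "\<And>a b. a \<in> topspace X \<Longrightarrow> b \<in> topspace X \<Longrightarrow> a \<in> L b \<longleftrightarrow> b \<in> R a"
    "\<And>a b. b \<in> topspace X \<Longrightarrow> a \<in> L b \<Longrightarrow> L a \<subseteq> L b"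
    using irreducible_between_order[OF Hausdorff_imp_t1_space[OF H] irr] by blast
  define r where "r = {(a, b). a \<in> topspace X \<and> b \<in> topspace X \<and> (a = b \<or> a \<in> L b)}"
  have lin: "linear_order_on (topspace X) r"
    unfolding linear_order_on_def partial_order_on_def preorder_on_def
  proof (intro conjI)
    show "r \<subseteq> topspace X \<times> topspace X" "refl_on (topspace X) r"
      by (auto simp: r_def refl_on_def)
    show "trans r"
      using LR(8) unfolding trans_def r_def by blast
    show "antisym r"
      unfolding antisym_def r_def using LR(3,7) by blast
    show "total_on (topspace X) r"
      unfolding total_on_def r_def using LR(4,7) by blast
  qed
  let ?T = "order_topology_on (topspace X) r"
  have sets: "{z \<in> topspace X. (z, a) \<in> r - Id} = L a" "{z \<in> topspace X. (a, z) \<in> r - Id} = R a"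
    if "a \<in> topspace X" for a
    using that LR(4)[OF that] LR(7) unfolding r_def by auto
  have gen: "?T = topology_generated_by ({topspace X} \<union> {L a |a. a \<in> topspace X} \<union> {R a |a. a \<in> topspace X})"
    unfolding order_topology_on_def Setcompr_eq_image
    by (simp only: image_cong[OF refl sets(1)] image_cong[OF refl sets(2)])
  have top: "topspace ?T = topspace X"
    unfolding gen using LR(4) by auto
  have op: "openin ?T (L a)" "openin ?T (R a)" if "a \<in> topspace X" for a
    unfolding gen by (rule topology_generated_by_Basis, use that in blast)+
  have cont: "continuous_map X ?T id"
    unfolding gen
  proof (rule continuous_on_generated_topo)
    fix U assume "U \<in> {topspace X} \<union> {L a |a. a \<in> topspace X} \<union> {R a |a. a \<in> topspace X}"
    then have "openin X U"
      using LR(1,2) by auto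
    then show "openin X (id -` U \<inter> topspace X)"
      by (simp add: openin_Int)
  qed auto
  have "connectedin ?T (id ` topspace X)"
    using X connectedin_topspace by (intro connectedin_continuous_map_image[OF cont]) blast
  then have conn: "connected_space ?T"
    by (metis connectedin_topspace image_id id_apply top)
  have sep: "\<exists>U V. openin ?T U \<and> openin ?T V \<and> a \<in> U \<and> b \<in> V \<and> disjnt U V"
    if ab: "a \<in> topspace X" "b \<in> topspace X" "a \<in> L b" for a b
  proof -
    \<comment> \<open>The order is dense: without a point between \<open>a\<close> and
      \<open>b\<close>, the open rays \<open>R a\<close> and \<open>L b\<close> would separate
      \<open>X\<close>. The rays at an intermediate point \<open>c\<close> then separate
      \<open>a\<close> from \<open>b\<close>.\<close>
    have "R a \<inter> L b \<noteq> {}"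
    proof
      assume "R a \<inter> L b = {}"
      moreover have "topspace X \<subseteq> R a \<union> L b"
        using LR(4)[OF ab(1)] LR(8)[OF ab(2,3)] ab by blast
      moreover have "b \<in> R a"
        using ab LR(7) by blast
      ultimately show False
        using X LR(1,2) ab unfolding connected_space_def by blast
    qed
    then obtain c where c: "c \<in> R a" "c \<in> L b"
      by blast
    then have "c \<in> topspace X"
      using LR(4) ab by blast
    then have "a \<in> L c" "b \<in> R c" "disjnt (L c) (R c)" "openin ?T (L c)" "openin ?T (R c)"
      using c LR(3,7) ab op by (auto simp: disjnt_def)
    then show ?thesis
      by blast
  qed
  have "Hausdorff_space ?T"
    unfolding Hausdorff_space_def top
  proof (intro allI impI)
    fix a b assume ab: "a \<in> topspace X \<and> b \<in> topspace X \<and> a \<noteq> b"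
    then have "a \<in> L b \<or> b \<in> L a"
      using LR(4,7) by blast
    then show "\<exists>U V. openin ?T U \<and> openin ?T V \<and> a \<in> U \<and> b \<in> V \<and> disjnt U V"
      using sep ab disjnt_sym by metis
  qed
  then have "homeomorphic_map X ?T id"
    using cont cpt top by (intro continuous_imp_homeomorphic_map) auto
  then have eq: "X = ?T"
    by (metis homeomorphic_map_id)
  have "linear_continuum_on (topspace X) r"
    using lin conn by (simp add: linear_continuum_on_def)
  moreover have "\<forall>z\<in>topspace X. (p, z) \<in> r \<and> (z, q) \<in> r"
    using LR(5,6,7) pq unfolding r_def by blast
  ultimately show ?thesis
    using eq by (intro exI[of _ r] conjI)
qed

text \<open>If the intersection split into two pieces, disjoint open sets \<open>U\<close> and
  \<open>V\<close> would contain them. Compactness then puts a whole member of the chain into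
  \<open>U \<union> V\<close>, although that member is connected and meets both.\<close>

lemma connectedin_Inter_chain:
  assumes X: "Hausdorff_space X" and ne: "\<C> \<noteq> {}"
    and cpt: "\<And>S. S \<in> \<C> \<Longrightarrow> compactin X S" and conn: "\<And>S. S \<in> \<C> \<Longrightarrow> connectedin X S"
    and chain: "\<And>S T. S \<in> \<C> \<Longrightarrow> T \<in> \<C> \<Longrightarrow> S \<subseteq> T \<or> T \<subseteq> S"
  shows "connectedin X (\<Inter>\<C>)"
proof (rule ccontr)
  assume "\<not> connectedin X (\<Inter>\<C>)"
  have cl: "closedin X S" if "S \<in> \<C>" for S
    by (rule compactin_imp_closedin[OF X cpt[OF that]])
  obtain S0 where S0: "S0 \<in> \<C>"
    using ne by blast
  have M: "closedin X (\<Inter>\<C>)" "compactin X (\<Inter>\<C>)"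
    using closedin_Inter[OF ne cl] closed_compactin_Inter[OF cpt[OF S0] S0 cl] by simp_all
  obtain E1 E2 where E: "closedin X E1" "closedin X E2" "\<Inter>\<C> \<subseteq> E1 \<union> E2"
    "E1 \<inter> E2 \<inter> \<Inter>\<C> = {}" "E1 \<inter> \<Inter>\<C> \<noteq> {}" "E2 \<inter> \<Inter>\<C> \<noteq> {}"
    using \<open>\<not> connectedin X (\<Inter>\<C>)\<close> closedin_subset[OF M(1)] unfolding connectedin_closedin by blast
  have "compactin X (E1 \<inter> \<Inter>\<C>)" "compactin X (E2 \<inter> \<Inter>\<C>)" "disjnt (E1 \<inter> \<Inter>\<C>) (E2 \<inter> \<Inter>\<C>)"
    using E M by (auto simp: disjnt_def closed_Int_compactin)
  then obtain U V where UV: "openin X U" "openin X V" "E1 \<inter> \<Inter>\<C> \<subseteq> U" "E2 \<inter> \<Inter>\<C> \<subseteq> V" "disjnt U V"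
    using Hausdorff_space_compact_separation[OF X] by metis
  have out: "S - (U \<union> V) \<noteq> {}" if S: "S \<in> \<C>" for S
  proof
    assume "S - (U \<union> V) = {}"
    moreover have "U \<inter> S \<noteq> {}" "V \<inter> S \<noteq> {}"
      using E UV S by blast+
    ultimately show False
      using connectedinD[OF conn[OF S] UV(1,2)] UV(5) by (auto simp: disjnt_def)
  qed
  \<comment> \<open>The lower bound is kept inside \<open>S0\<close> because only \<open>S0\<close>
    is covered by the finite subfamily below.\<close>
  have fin: "\<exists>T\<in>\<C>. T \<subseteq> S0 \<and> (\<forall>S\<in>\<F>. T \<subseteq> S)" if "finite \<F>" "\<F> \<subseteq> \<C>" for \<F>
    using that
  proof induction
    case empty
    then show ?case using S0 by blast
  next
    case (insert S \<F>)
    then obtain T where T: "T \<in> \<C>" "T \<subseteq> S0" "\<forall>S\<in>\<F>. T \<subseteq> S"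
      by blast
    have S: "S \<in> \<C>"
      using insert.prems by blast
    consider "S \<subseteq> T" | "T \<subseteq> S"
      using chain[OF S T(1)] by blast
    then show ?case
    proof cases
      case 1
      with S T show ?thesis by (intro bexI[of _ S]) auto
    next
      case 2
      with T show ?thesis by (intro bexI[of _ T]) auto
    qed
  qed
  have "S0 \<subseteq> \<Union>({U, V} \<union> (\<lambda>S. topspace X - S) ` \<C>)"
  proof
    fix s assume "s \<in> S0"
    then have "s \<in> topspace X"
      using compactin_subset_topspace[OF cpt[OF S0]] by blast
    moreover have "s \<in> U \<union> V" if "s \<in> \<Inter>\<C>"
      using E(3) UV(3,4) that by blast
    ultimately show "s \<in> \<Union>({U, V} \<union> (\<lambda>S. topspace X - S) ` \<C>)"
      by auto
  qed
  moreover have "openin X W" if "W \<in> {U, V} \<union> (\<lambda>S. topspace X - S) ` \<C>" for W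
    using that UV cl by auto
  ultimately obtain \<W> where \<W>: "finite \<W>" "\<W> \<subseteq> {U, V} \<union> (\<lambda>S. topspace X - S) ` \<C>" "S0 \<subseteq> \<Union>\<W>"
    using cpt[OF S0] unfolding compactin_def by metis
  have "finite (\<W> - {U, V})" "\<W> - {U, V} \<subseteq> (\<lambda>S. topspace X - S) ` \<C>"
    using \<W> by auto
  then obtain \<F> where \<F>: "finite \<F>" "\<F> \<subseteq> \<C>" "\<W> - {U, V} = (\<lambda>S. topspace X - S) ` \<F>"
    by (meson finite_subset_image)
  obtain T where T: "T \<in> \<C>" "T \<subseteq> S0" "\<forall>S\<in>\<F>. T \<subseteq> S"
    using fin[OF \<F>(1,2)] by blast
  have "T \<subseteq> U \<union> V"
  proof
    fix t assume t: "t \<in> T"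
    then obtain W where W: "W \<in> \<W>" "t \<in> W"
      using T \<W> by blast
    show "t \<in> U \<union> V"
    proof (rule ccontr)
      assume "t \<notin> U \<union> V"
      with W have "W \<in> (\<lambda>S. topspace X - S) ` \<F>"
        unfolding \<F>(3)[symmetric] by auto
      then show False
        using W T t by auto
    qed
  qed
  then show False
    using out[OF T(1)] by blast
qed

section \<open>Convexity spaces\<close>

lemma convex_underD: "convex_under K A \<Longrightarrow> a \<in> A \<Longrightarrow> b \<in> A \<Longrightarrow> K (a, b) \<subseteq> A"
  by (simp add: convex_under_def)

lemma convex_under_Int: "convex_under K A \<Longrightarrow> convex_under K B \<Longrightarrow> convex_under K (A \<inter> B)"
  by (simp add: convex_under_def)

lemma convexity_space_segment:
  assumes "convexity_space X K" "a \<in> topspace X" "b \<in> topspace X"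
  shows "connectedin X (K (a, b))" "a \<in> K (a, b)" "b \<in> K (a, b)" "convex_under K (K (a, b))"
    "K (a, b) \<subseteq> topspace X"
    "\<And>A. connectedin X A \<Longrightarrow> a \<in> A \<Longrightarrow> b \<in> A \<Longrightarrow> A \<subseteq> K (a, b) \<Longrightarrow> A = K (a, b)"
  using assms connectedin_subset_topspace unfolding convexity_space_def by metis+

text \<open>A convex set is the union of the segments from any one of its points. With (C3) this
  makes segments locally connected.\<close>

lemma convexity_space_convex_connectedin:
  assumes X: "convexity_space X K" and A: "A \<subseteq> topspace X" "convex_under K A"
  shows "connectedin X A"
proof (cases "A = {}")
  case False
  then obtain a where a: "a \<in> A"
    by blast
  have "connectedin X (\<Union>b\<in>A. K (a, b))"
  proof (rule connectedin_Union)
    show "connectedin X S" if "S \<in> (\<lambda>b. K (a, b)) ` A" for S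
      using that a A(1) convexity_space_segment(1)[OF X] by blast
    have "a \<in> K (a, b)" if "b \<in> A" for b
      using that a A(1) convexity_space_segment(2)[OF X] by blast
    then show "(\<Inter>b\<in>A. K (a, b)) \<noteq> {}"
      by blast
  qed
  moreover have "(\<Union>b\<in>A. K (a, b)) = A"
  proof
    show "(\<Union>b\<in>A. K (a, b)) \<subseteq> A"
      using convex_underD[OF A(2) a] by blast
    have "b \<in> K (a, b)" if "b \<in> A" for b
      using that a A(1) convexity_space_segment(3)[OF X] by blast
    then show "A \<subseteq> (\<Union>b\<in>A. K (a, b))"
      by blast
  qed
  ultimately show ?thesis
    by simp
qed simp

text \<open>This is (C2) in the form that gives access to the cut point order.\<close>

lemma convexity_space_segment_irreducible:
  assumes X: "convexity_space X K" and ab: "a \<in> topspace X" "b \<in> topspace X"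
  shows "irreducible_between (subtopology X (K (a, b))) a b"
proof -
  note seg = convexity_space_segment[OF X ab]
  have "connected_space (subtopology X (K (a, b)))"
    using seg(1) by (simp add: connectedin_def)
  moreover have "topspace (subtopology X (K (a, b))) = K (a, b)"
    using seg(5) by auto
  ultimately show ?thesis
    using seg(2,3,6) by (simp add: irreducible_between_def connectedin_subtopology)
qed

text \<open>Compactness of segments is not an axiom. The convex basis sets from (C3) meet a segment
  in convex, hence connected sets, so the Heine-Borel argument for locally connected irreducible
  spaces applies.\<close>

lemma convexity_space_segment_compactin:
  assumes X: "convexity_space X K" and ab: "a \<in> topspace X" "b \<in> topspace X"
  shows "compactin X (K (a, b))"
proof -
  note seg = convexity_space_segment[OF X ab]
  let ?Z = "subtopology X (K (a, b))"
  have lc: "locally_connected_space ?Z"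
    unfolding locally_connected_space
  proof (intro allI impI)
    fix V c assume V: "openin ?Z V \<and> c \<in> V"
    then obtain W where W: "openin X W" "V = W \<inter> K (a, b)"
      by (auto simp: openin_subtopology)
    have "\<forall>W x. openin X W \<and> x \<in> W \<longrightarrow>
        (\<exists>B. openin X B \<and> convex_under K B \<and> x \<in> B \<and> B \<subseteq> W)"
      using X unfolding convexity_space_def by (elim conjE)
    moreover have "c \<in> W"
      using V W by simp
    ultimately obtain B where B: "openin X B" "convex_under K B" "c \<in> B" "B \<subseteq> W"
      using W(1) by meson
    have "connectedin X (B \<inter> K (a, b))"
      using convexity_space_convex_connectedin[OF X _ convex_under_Int[OF B(2) seg(4)]] seg(5) by blast
    then have "openin ?Z (B \<inter> K (a, b)) \<and> connectedin ?Z (B \<inter> K (a, b)) \<and>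
        c \<in> B \<inter> K (a, b) \<and> B \<inter> K (a, b) \<subseteq> V"
      using B V W by (auto simp: connectedin_subtopology openin_subtopology_Int)
    then show "\<exists>U. openin ?Z U \<and> connectedin ?Z U \<and> c \<in> U \<and> U \<subseteq> V"
      by (rule exI)
  qed
  have "t1_space ?Z"
    using X by (simp add: convexity_space_def Hausdorff_space_subtopology Hausdorff_imp_t1_space)
  then have "compact_space ?Z"
    by (rule compact_space_irreducible_between[OF _ convexity_space_segment_irreducible[OF X ab] lc])
  then show ?thesis
    using seg(5) by (simp add: compactin_subspace)
qed

text \<open>Continuity of \<open>K\<close> at \<open>(a, b)\<close>, tested on the basic open set
  \<open>Pow W\<close>.\<close>

lemma convexity_space_segment_upper_semicontinuous:
  assumes X: "convexity_space X K" and ab: "a \<in> topspace X" "b \<in> topspace X"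
    and W: "openin X W" "K (a, b) \<subseteq> W"
  obtains U V where "openin X U" "openin X V" "a \<in> U" "b \<in> V"
    "\<And>c d. c \<in> U \<Longrightarrow> d \<in> V \<Longrightarrow> K (c, d) \<subseteq> W"
proof -
  let ?S = "{u \<in> topspace (prod_topology X X). K u \<in> Pow W}"
  have "openin (powerset_topology X) (Pow W)"
    unfolding powerset_topology_def using W by (intro topology_generated_by_Basis) blast
  then have S: "openin (prod_topology X X) ?S"
    using X unfolding convexity_space_def by (intro openin_continuous_map_preimage) auto
  have "(a, b) \<in> ?S"
    using ab W by simp
  from openin_prod_topology_alt[THEN iffD1, rule_format, OF S this] obtain U V where UV: "openin X U" "openin X V" "a \<in> U" "b \<in> V" "U \<times> V \<subseteq> ?S"
    by (elim exE conjE)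
  have "K (c, d) \<subseteq> W" if "c \<in> U" "d \<in> V" for c d
    using UV(5) that by auto
  then show thesis
    using that UV(1-4) by blast
qed

text \<open>Minimality of segments supplies the lower semicontinuity that the topology on the power set
  does not ask for: an inner point \<open>z\<close> of \<open>K (a, b)\<close> cuts it, so a nearby segment avoiding a
  neighbourhood of \<open>z\<close> would be disconnected.\<close>

lemma convexity_space_convex_closure_of:
  assumes X: "convexity_space X K" and A: "convex_under K A"
  shows "convex_under K (X closure_of A)"
  unfolding convex_under_def
proof (intro ballI subsetI, rule ccontr)
  fix a b z
  assume a: "a \<in> X closure_of A" and b: "b \<in> X closure_of A" and z: "z \<in> K (a, b)"
    and nz: "z \<notin> X closure_of A"
  have H: "Hausdorff_space X"
    using X by (simp add: convexity_space_def)
  have ab: "a \<in> topspace X" "b \<in> topspace X"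
    using a b by (auto simp: in_closure_of)
  note seg = convexity_space_segment[OF X ab]
  let ?S = "K (a, b)"
  let ?Z = "subtopology X ?S"
  have topZ: "topspace ?Z = ?S"
    using seg(5) by auto
  define N where "N = topspace X - X closure_of A"
  have N: "openin X N" "z \<in> N"
    using z nz seg(5) by (auto simp: N_def)
  have NA: "A \<inter> N = {}"
    unfolding N_def using closure_of_subset_Int[of X A] by blast
  have cptZ: "compact_space ?Z"
    using convexity_space_segment_compactin[OF X ab] by (simp add: compactin_subspace)
  obtain L R where LR: "openin ?Z L" "openin ?Z R" "L \<inter> R = {}" "L \<union> R = ?S - {z}"
    "a \<in> insert z L" "b \<in> insert z R"
    using irreducible_between_cut[OF _ convexity_space_segment_irreducible[OF X ab], of z]
      H z topZ by (auto simp: Hausdorff_space_subtopology Hausdorff_imp_t1_space)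
  have NZ: "openin ?Z (N \<inter> ?S)"
    using N by (simp add: openin_subtopology_Int)
  \<comment> \<open>For \<open>D = R\<close> and \<open>D = L\<close> these are the parts of the two
    sides of \<open>z\<close> outside \<open>N\<close>. Being compact and disjoint, they have
    disjoint neighbourhoods \<open>P\<close> and \<open>Q\<close> in \<open>X\<close>, and the whole
    segment lies in \<open>P \<union> N \<union> Q\<close>.\<close>
  have cpt: "compactin X (?S - (D \<union> N \<inter> ?S))" if "openin ?Z D" for D
  proof -
    have "closedin ?Z (topspace ?Z - (D \<union> N \<inter> ?S))"
      using that NZ by (intro closedin_diff openin_Un closedin_topspace)
    then have "compactin ?Z (?S - (D \<union> N \<inter> ?S))"
      using cptZ closedin_compact_space topZ by metis
    then show ?thesis
      by (simp add: compactin_subtopology)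
  qed
  have "disjnt (?S - (R \<union> N \<inter> ?S)) (?S - (L \<union> N \<inter> ?S))"
    using LR(4) N(2) by (auto simp: disjnt_def)
  then obtain P Q where PQ: "openin X P" "openin X Q" "?S - (R \<union> N \<inter> ?S) \<subseteq> P"
      "?S - (L \<union> N \<inter> ?S) \<subseteq> Q" "disjnt P Q"
    using Hausdorff_space_compact_separation[OF H cpt[OF LR(2)] cpt[OF LR(1)]] by metis
  have "a \<notin> N" "b \<notin> N"
    using a b by (auto simp: N_def)
  then have aP: "a \<in> P" and bQ: "b \<in> Q"
    using LR(3,5,6) N(2) seg(2,3) PQ(3,4) by auto
  have "?S \<subseteq> P \<union> N \<union> Q"
    using PQ(3,4) LR(3) by auto
  then obtain U V where UV: "openin X U" "openin X V" "a \<in> U" "b \<in> V"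
      "\<And>c d. c \<in> U \<Longrightarrow> d \<in> V \<Longrightarrow> K (c, d) \<subseteq> P \<union> N \<union> Q"
    using convexity_space_segment_upper_semicontinuous[OF X ab, of "P \<union> N \<union> Q"] PQ N by blast
  \<comment> \<open>Points \<open>c\<close> and \<open>d\<close> of \<open>A\<close> are taken near
    \<open>a\<close> and \<open>b\<close>. Their segment stays in \<open>A\<close>, hence avoids
    \<open>N\<close>, and is torn apart by \<open>P\<close> and \<open>Q\<close>.\<close>
  obtain c where c: "c \<in> A" "c \<in> U \<inter> P"
    using a aP UV PQ unfolding in_closure_of by (metis IntI openin_Int)
  obtain d where d: "d \<in> A" "d \<in> V \<inter> Q"
    using b bQ UV PQ unfolding in_closure_of by (metis IntI openin_Int)
  have cd: "c \<in> topspace X" "d \<in> topspace X"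
    using c d openin_subset[OF UV(1)] openin_subset[OF UV(2)] by auto
  note seg' = convexity_space_segment[OF X cd]
  have "K (c, d) \<subseteq> A"
    using convex_underD[OF A] c d by blast
  moreover have "K (c, d) \<subseteq> P \<union> N \<union> Q"
    using UV(5) c d by blast
  ultimately have "K (c, d) \<subseteq> P \<union> Q"
    using NA by blast
  moreover have "P \<inter> Q \<inter> K (c, d) = {}" "P \<inter> K (c, d) \<noteq> {}" "Q \<inter> K (c, d) \<noteq> {}"
    using PQ(5) c d seg'(2,3) by (auto simp: disjnt_def)
  ultimately show False
    using connectedinD[OF seg'(1) PQ(1,2)] by blast
qed

section \<open>Convex sets in a local convexity structure\<close>

lemma chart_segment:
  assumes Y: "local_convexity_structure Y \<V>" and V: "(V, K) \<in> \<V>" and ab: "a \<in> V" "b \<in> V"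
  shows "K (a, b) \<subseteq> V" "connectedin Y (K (a, b))" "a \<in> K (a, b)" "b \<in> K (a, b)"
proof -
  have "openin Y V" "convexity_space (subtopology Y V) K"
    using Y V unfolding local_convexity_structure_def by auto
  moreover from this have "a \<in> topspace (subtopology Y V)" "b \<in> topspace (subtopology Y V)"
    using ab openin_subset by auto
  ultimately show "K (a, b) \<subseteq> V" "connectedin Y (K (a, b))" "a \<in> K (a, b)" "b \<in> K (a, b)"
    using convexity_space_segment[of "subtopology Y V" K a b] by (auto simp: connectedin_subtopology)
qed

lemma chart_cover:
  assumes Y: "local_convexity_structure Y \<V>" and a: "a \<in> topspace Y"
  obtains V K where "(V, K) \<in> \<V>" "openin Y V" "a \<in> V"
proof -
  obtain c where "c \<in> \<V>" "a \<in> fst c"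
    using Y a unfolding local_convexity_structure_def by blast
  then show thesis
    using that[of "fst c" "snd c"] Y unfolding local_convexity_structure_def by auto
qed

lemma locally_convex_setI:
  assumes "A \<subseteq> topspace Y"
    "\<And>V K a b. (V, K) \<in> \<V> \<Longrightarrow> a \<in> A \<Longrightarrow> b \<in> A \<Longrightarrow> a \<in> V \<Longrightarrow> b \<in> V \<Longrightarrow> K (a, b) \<subseteq> A \<inter> V"
  shows "locally_convex_set Y \<V> A"
  unfolding locally_convex_set_def convex_under_def
proof (intro conjI ballI, rule assms(1), clarify)
  fix V K a b assume "(V, K) \<in> \<V>" "a \<in> A" "b \<in> A" "a \<in> V" "b \<in> V"
  then have "K (a, b) \<subseteq> A \<inter> V"
    by (rule assms(2))
  then show "\<And>c. c \<in> K (a, b) \<Longrightarrow> c \<in> A \<inter> V"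
    by blast
qed

lemma locally_convex_setD:
  assumes "locally_convex_set Y \<V> A" "(V, K) \<in> \<V>" "a \<in> A" "b \<in> A" "a \<in> V" "b \<in> V"
  shows "K (a, b) \<subseteq> A"
proof -
  have "convex_under K (A \<inter> V)"
    using assms(1,2) unfolding locally_convex_set_def by blast
  then show ?thesis
    using convex_underD[of K "A \<inter> V" a b] assms(3-6) by blast
qed

lemma locally_convex_set_subset: "locally_convex_set Y \<V> A \<Longrightarrow> A \<subseteq> topspace Y"
  by (simp add: locally_convex_set_def)

lemma locally_convex_set_Inter:
  assumes Y: "local_convexity_structure Y \<V>" and ne: "\<A> \<noteq> {}"
    and \<A>: "\<And>A. A \<in> \<A> \<Longrightarrow> locally_convex_set Y \<V> A"
  shows "locally_convex_set Y \<V> (\<Inter>\<A>)"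
proof (rule locally_convex_setI)
  obtain A where "A \<in> \<A>"
    using ne by blast
  then show "\<Inter>\<A> \<subseteq> topspace Y"
    using \<A> locally_convex_set_subset by (metis Inter_lower subset_trans)
  show "K (a, b) \<subseteq> \<Inter>\<A> \<inter> V"
    if "(V, K) \<in> \<V>" "a \<in> \<Inter>\<A>" "b \<in> \<Inter>\<A>" "a \<in> V" "b \<in> V" for V K a b
  proof -
    have "K (a, b) \<subseteq> A" if "A \<in> \<A>" for A
      using locally_convex_setD[OF \<A> \<open>(V, K) \<in> \<V>\<close>] that \<open>a \<in> \<Inter>\<A>\<close> \<open>b \<in> \<Inter>\<A>\<close> \<open>a \<in> V\<close> \<open>b \<in> V\<close>
      by (meson InterE)
    then show ?thesis
      using chart_segment(1)[OF Y that(1,4,5)] by blast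
  qed
qed

lemma locally_convex_set_topspace:
  assumes Y: "local_convexity_structure Y \<V>"
  shows "locally_convex_set Y \<V> (topspace Y)"
proof (rule locally_convex_setI)
  fix V K a b assume *: "(V, K) \<in> \<V>" "a \<in> V" "b \<in> V"
  show "K (a, b) \<subseteq> topspace Y \<inter> V"
    using chart_segment(1,2)[OF Y *] connectedin_subset_topspace by (metis Int_subset_iff)
qed simp

text \<open>The hull is an intersection of convex sets, and \<open>topspace Y\<close> ensures that
  the intersected family is nonempty.\<close>

lemma locally_convex_set_hull:
  assumes Y: "local_convexity_structure Y \<V>" and A: "A \<subseteq> topspace Y"
  shows "locally_convex_set Y \<V> (convex_hull_in Y \<V> A)"
  unfolding convex_hull_in_def hull_def
  by (rule locally_convex_set_Inter[OF Y]) (use locally_convex_set_topspace[OF Y] A in auto)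

text \<open>Charts are open, so the closure of \<open>A \<inter> V\<close> relative to
  \<open>V\<close> is the trace of the closure of \<open>A\<close>, and the result for a single
  convexity space applies.\<close>

lemma locally_convex_set_closure_of:
  assumes Y: "local_convexity_structure Y \<V>" and A: "locally_convex_set Y \<V> A"
  shows "locally_convex_set Y \<V> (Y closure_of A)"
  unfolding locally_convex_set_def
proof (intro conjI closure_of_subset_topspace ballI, clarify)
  fix V K assume V: "(V, K) \<in> \<V>"
  have op: "openin Y V" and X: "convexity_space (subtopology Y V) K"
    using Y V unfolding local_convexity_structure_def by auto
  have cv: "convex_under K (A \<inter> V)"
    using A V unfolding locally_convex_set_def by auto
  have "subtopology Y V closure_of (A \<inter> V) = subtopology Y V closure_of A"
    using closure_of_restrict[of "subtopology Y V" A] openin_subset[OF op]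
    by (metis Int_commute inf.absorb_iff2 topspace_subtopology)
  also have "\<dots> = Y closure_of A \<inter> V"
    using closure_of_subtopology_open[of Y V A] op by auto
  finally show "convex_under K (Y closure_of A \<inter> V)"
    using convexity_space_convex_closure_of[OF X cv] by simp
qed

text \<open>A segment of \<open>D\<close> with end points in the component is connected, so the
  component absorbs it.\<close>

lemma locally_convex_set_connected_component:
  assumes Y: "local_convexity_structure Y \<V>" and D: "locally_convex_set Y \<V> D"
  shows "locally_convex_set Y \<V> (connected_component_of_set (subtopology Y D) x)" (is "locally_convex_set Y \<V> ?C")
proof (rule locally_convex_setI)
  have C: "connectedin Y ?C" "?C \<subseteq> D"
    using connectedin_connected_component_of[of "subtopology Y D" x] by (auto simp: connectedin_subtopology)
  then show "?C \<subseteq> topspace Y"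
    using connectedin_subset_topspace by blast
  fix V K a b assume V: "(V, K) \<in> \<V>" and ab: "a \<in> ?C" "b \<in> ?C" "a \<in> V" "b \<in> V"
  note seg = chart_segment[OF Y V ab(3,4)]
  have "K (a, b) \<subseteq> D"
    using locally_convex_setD[OF D V _ _ ab(3,4)] ab C(2) by blast
  then have "connectedin (subtopology Y D) (?C \<union> K (a, b))"
    using connectedin_Un[OF C(1) seg(2)] C(2) ab(1) seg(3) by (auto simp: connectedin_subtopology)
  \<comment> \<open>The component is empty when \<open>x\<close> is not in the space; here the
    element \<open>a\<close> excludes this.\<close>
  moreover have "x \<in> ?C"
    using ab(1) connected_component_of_refl connected_component_of_equiv by (metis mem_Collect_eq)
  ultimately have "?C \<union> K (a, b) \<subseteq> ?C"
    by (intro connected_component_of_maximal) auto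
  then show "K (a, b) \<subseteq> ?C \<inter> V"
    using seg(1) by blast
qed

text \<open>(G1) speaks of finite sets only, so the arc has to be replaced by something in the hull
  of finitely many of its points. The points of \<open>A\<close> reachable from \<open>x\<close> in
  this way are clopen in \<open>A\<close>: two points of \<open>A\<close> in one chart are joined by
  a segment, at the cost of adding both to \<open>F\<close>. The set \<open>P\<close> itself may
  leave \<open>A\<close>.\<close>

lemma polygonal_connection:
  assumes Y: "local_convexity_structure Y \<V>" and A: "connectedin Y A" and x: "x \<in> A" and y: "y \<in> A"
  shows "\<exists>F P. finite F \<and> F \<subseteq> A \<and> connectedin Y P \<and> x \<in> P \<and> y \<in> P \<and> P \<subseteq> convex_hull_in Y \<V> F"
proof -
  have sub: "A \<subseteq> topspace Y"
    using A connectedin_subset_topspace by blast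
  define S where "S = {a \<in> A. \<exists>F P. finite F \<and> F \<subseteq> A \<and> connectedin Y P \<and> x \<in> P \<and> a \<in> P \<and>
    P \<subseteq> convex_hull_in Y \<V> F}"
  have topA: "topspace (subtopology Y A) = A"
    using sub by auto
  have "S = topspace (subtopology Y A)"
  proof (rule connected_space_induct)
    show "connected_space (subtopology Y A)"
      using A by (simp add: connectedin_def)
    show "S \<subseteq> topspace (subtopology Y A)"
      unfolding topA S_def by blast
    have "finite {x} \<and> {x} \<subseteq> A \<and> connectedin Y {x} \<and> x \<in> {x} \<and> x \<in> {x} \<and> {x} \<subseteq> convex_hull_in Y \<V> {x}"
      using x sub by (auto simp: convex_hull_in_def hull_inc)
    then have "x \<in> S"
      unfolding S_def using x by blast
    then show "S \<noteq> {}"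
      by blast
    fix a assume "a \<in> topspace (subtopology Y A)"
    then have a: "a \<in> A" "a \<in> topspace Y"
      using topA sub by auto
    obtain V K where V: "(V, K) \<in> \<V>" "openin Y V" "a \<in> V"
      using chart_cover[OF Y a(2)] by blast
    have "b \<in> S" if s: "s \<in> S" "s \<in> V" and b: "b \<in> A" "b \<in> V" for s b
    proof -
      obtain F P where FP: "finite F" "F \<subseteq> A" "connectedin Y P" "x \<in> P" "s \<in> P"
        "P \<subseteq> convex_hull_in Y \<V> F" and sA: "s \<in> A"
        using s unfolding S_def by auto
      let ?F = "insert s (insert b F)" and ?P = "P \<union> K (s, b)"
      note seg = chart_segment[OF Y V(1) s(2) b(2)]
      have FA: "?F \<subseteq> A"
        using FP sA b by blast
      have "locally_convex_set Y \<V> (convex_hull_in Y \<V> ?F)"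
        using locally_convex_set_hull[OF Y] FA sub by blast
      moreover have "s \<in> convex_hull_in Y \<V> ?F" "b \<in> convex_hull_in Y \<V> ?F"
        unfolding convex_hull_in_def by (rule hull_inc, simp)+
      ultimately have "K (s, b) \<subseteq> convex_hull_in Y \<V> ?F"
        using locally_convex_setD[OF _ V(1)] s(2) b(2) by metis
      moreover have "convex_hull_in Y \<V> F \<subseteq> convex_hull_in Y \<V> ?F"
        unfolding convex_hull_in_def by (rule hull_mono) blast
      ultimately have "?P \<subseteq> convex_hull_in Y \<V> ?F"
        using FP(6) by blast
      moreover have "connectedin Y ?P"
        using connectedin_Un[OF FP(3) seg(2)] FP(5) seg(3) by blast
      ultimately have "finite ?F \<and> ?F \<subseteq> A \<and> connectedin Y ?P \<and> x \<in> ?P \<and> b \<in> ?P \<and> ?P \<subseteq> convex_hull_in Y \<V> ?F"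
        using FP FA seg(4) by simp
      then show ?thesis
        unfolding S_def using b(1) by blast
    qed
    then have "openin (subtopology Y A) (V \<inter> A) \<and> a \<in> V \<inter> A \<and> (S \<inter> (V \<inter> A) \<noteq> {} \<longrightarrow> V \<inter> A \<subseteq> S)"
      using V a by (auto simp: openin_subtopology_Int)
    then show "\<exists>B. openin (subtopology Y A) B \<and> a \<in> B \<and> (S \<inter> B \<noteq> {} \<longrightarrow> B \<subseteq> S)"
      by (rule exI)
  qed
  then have "y \<in> S"
    using y topA by simp
  then show ?thesis
    unfolding S_def by simp
qed

section \<open>Minimal arcs and geodesics\<close>

lemma exists_minimal_convex_continuum:
  assumes H: "Hausdorff_space Y" and Y: "local_convexity_structure Y \<V>"
    and D: "compactin Y D" "locally_convex_set Y \<V> D" and P: "connectedin Y P" "P \<subseteq> D" "F \<subseteq> P" "F \<noteq> {}"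
  obtains C where "C \<subseteq> D" "compactin Y C" "connectedin Y C" "locally_convex_set Y \<V> C" "F \<subseteq> C"
    "\<And>B. closedin Y B \<Longrightarrow> connectedin Y B \<Longrightarrow> locally_convex_set Y \<V> B \<Longrightarrow> F \<subseteq> B \<Longrightarrow> B \<subseteq> C \<Longrightarrow> B = C"
proof -
  define \<M> where
    "\<M> = {C. C \<subseteq> D \<and> closedin Y C \<and> connectedin Y C \<and> locally_convex_set Y \<V> C \<and> F \<subseteq> C}"
  obtain x where x: "x \<in> F"
    using P(4) by blast
  \<comment> \<open>\<open>P\<close> need not be convex or closed, but the component of
    \<open>D\<close> around it is both, so the family \<open>\<M>\<close> is nonempty.\<close>
  define C0 where "C0 = connected_component_of_set (subtopology Y D) x"
  have C0: "connectedin Y C0" "C0 \<subseteq> D"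
    using connectedin_connected_component_of[of "subtopology Y D" x]
    by (auto simp: C0_def connectedin_subtopology)
  have "connectedin (subtopology Y D) P"
    using P by (simp add: connectedin_subtopology)
  then have "P \<subseteq> C0"
    unfolding C0_def by (rule connected_component_of_maximal) (use P(3) x in blast)
  moreover have "closedin Y C0"
    unfolding C0_def
    by (rule closedin_trans_full[OF closedin_connected_component_of compactin_imp_closedin[OF H D(1)]])
  moreover have "locally_convex_set Y \<V> C0"
    unfolding C0_def by (rule locally_convex_set_connected_component[OF Y D(2)])
  ultimately have "C0 \<in> \<M>"
    using C0 P(3) by (simp add: \<M>_def)
  have cpt: "compactin Y C" if "C \<in> \<M>" for C
    using that closed_compactin[OF D(1)] by (simp add: \<M>_def)
  \<comment> \<open>Inclusion is reversed, so that Zorn's lemma yields a minimal set; the empty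
    chain is bounded by \<open>C0\<close>.\<close>
  have po: "partial_order_on \<M> (relation_of (\<lambda>A B. B \<subseteq> A) \<M>)"
    by (rule partial_order_on_relation_ofI) auto
  have "\<exists>C\<in>\<M>. \<forall>B\<in>\<M>. B \<subseteq> C \<longrightarrow> B = C"
  proof (rule predicate_Zorn[OF po])
    fix \<C> assume \<C>: "\<C> \<in> Chains (relation_of (\<lambda>A B. B \<subseteq> A) \<M>)"
    then have sub: "\<C> \<subseteq> \<M>" and chain: "\<And>S T. S \<in> \<C> \<Longrightarrow> T \<in> \<C> \<Longrightarrow> S \<subseteq> T \<or> T \<subseteq> S"
      unfolding Chains_def relation_of_def by auto
    show "\<exists>C\<in>\<M>. \<forall>B\<in>\<C>. C \<subseteq> B"
    proof (cases "\<C> = {}")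
      case True
      then show ?thesis
        using \<open>C0 \<in> \<M>\<close> by blast
    next
      case False
      then obtain S where S: "S \<in> \<C>"
        by blast
      have mem: "T \<subseteq> D" "closedin Y T" "connectedin Y T" "locally_convex_set Y \<V> T" "F \<subseteq> T"
        if "T \<in> \<C>" for T
        using sub that unfolding \<M>_def by auto
      have "\<Inter>\<C> \<subseteq> D"
        using mem(1)[OF S] S by blast
      moreover have "closedin Y (\<Inter>\<C>)"
        by (rule closedin_Inter[OF False mem(2)])
      moreover have "connectedin Y (\<Inter>\<C>)"
        by (rule connectedin_Inter_chain[OF H False _ mem(3) chain]) (use cpt sub in auto)
      moreover have "locally_convex_set Y \<V> (\<Inter>\<C>)"
        by (rule locally_convex_set_Inter[OF Y False mem(4)])
      moreover have "F \<subseteq> \<Inter>\<C>"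
        using mem(5) by (rule Inter_greatest)
      ultimately have "\<Inter>\<C> \<in> \<M>"
        by (simp add: \<M>_def)
      then show ?thesis
        by (intro bexI[of _ "\<Inter>\<C>"]) auto
    qed
  qed
  then obtain C where C: "C \<in> \<M>" and min: "\<And>B. B \<in> \<M> \<Longrightarrow> B \<subseteq> C \<Longrightarrow> B = C"
    by blast
  show thesis
  proof (rule that[of C])
    show "C \<subseteq> D" "connectedin Y C" "locally_convex_set Y \<V> C" "F \<subseteq> C"
      using C by (auto simp: \<M>_def)
    then show "B = C" if "closedin Y B" "connectedin Y B" "locally_convex_set Y \<V> B" "F \<subseteq> B" "B \<subseteq> C" for B
      using that by (intro min) (auto simp: \<M>_def)
    show "compactin Y C"
      by (rule cpt[OF C])
  qed
qed

lemma maps_onto_convex_inclusion: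
  assumes "U \<subseteq> C" "U \<subseteq> V" "convex_under K U"
  shows "maps_onto_convex (subtopology Y C) Y (\<lambda>z. z) U (V, K)"
  using assms homeomorphic_map_id[of "subtopology Y U" "subtopology Y U"]
  by (simp add: maps_onto_convex_def subtopology_subtopology Int_absorb1 id_def)

text \<open>The sets \<open>C \<inter> V\<close> are etale charts of the inclusion. A set refuting
  generation by the end points would be convex in all of them, hence a proper convex subcontinuum of
  \<open>C\<close>, against minimality.\<close>

lemma simple_geodesic_of_minimal:
  assumes H: "Hausdorff_space Y" and Y: "local_convexity_structure Y \<V>"
    and C: "compactin Y C" "connectedin Y C" "locally_convex_set Y \<V> C" "x \<in> C" "y \<in> C"
    and min: "\<And>B. closedin Y B \<Longrightarrow> connectedin Y B \<Longrightarrow> locally_convex_set Y \<V> B \<Longrightarrow> {x, y} \<subseteq> B \<Longrightarrow>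
      B \<subseteq> C \<Longrightarrow> B = C"
  shows "simple_geodesic Y \<V> x y C"
proof -
  let ?T = "subtopology Y C"
  have CY: "C \<subseteq> topspace Y" and clC: "closedin Y C"
    using C H connectedin_subset_topspace compactin_imp_closedin by auto
  have topC: "topspace ?T = C"
    using CY by auto
  have chart: "openin ?T (C \<inter> V)" "maps_onto_convex ?T Y (\<lambda>z. z) (C \<inter> V) (V, K)"
      "C \<inter> V \<in> etale_charts ?T Y \<V> (\<lambda>z. z)" if V: "(V, K) \<in> \<V>" for V K
  proof -
    have "openin Y V"
      using Y V unfolding local_convexity_structure_def by auto
    then show op: "openin ?T (C \<inter> V)"
      by (simp add: openin_subtopology_Int2)
    have "convex_under K (C \<inter> V)"
      using C(3) V unfolding locally_convex_set_def by auto
    then show mc: "maps_onto_convex ?T Y (\<lambda>z. z) (C \<inter> V) (V, K)"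
      by (intro maps_onto_convex_inclusion) auto
    show "C \<inter> V \<in> etale_charts ?T Y \<V> (\<lambda>z. z)"
      unfolding etale_charts_def using op mc V by blast
  qed
  have "etale ?T Y \<V> (\<lambda>z. z)"
    unfolding etale_def
  proof (intro conjI)
    show "connected_space ?T"
      using C(2) by (simp add: connectedin_def)
    show "continuous_map ?T Y (\<lambda>z. z)"
      using continuous_map_from_subtopology[OF continuous_map_id, of Y C] by (simp add: id_def)
    show "closed_map ?T Y (\<lambda>z. z)"
      unfolding closed_map_def using closedin_trans_full clC by auto
    show "\<Union>(etale_charts ?T Y \<V> (\<lambda>z. z)) = topspace ?T"
    proof
      show "\<Union>(etale_charts ?T Y \<V> (\<lambda>z. z)) \<subseteq> topspace ?T"
        unfolding etale_charts_def using openin_subset by blast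
      show "topspace ?T \<subseteq> \<Union>(etale_charts ?T Y \<V> (\<lambda>z. z))"
      proof
        fix a assume "a \<in> topspace ?T"
        then have a: "a \<in> C" "a \<in> topspace Y"
          by auto
        then obtain V K where V: "(V, K) \<in> \<V>" "a \<in> V"
          using chart_cover[OF Y] by metis
        then show "a \<in> \<Union>(etale_charts ?T Y \<V> (\<lambda>z. z))"
          using chart(3)[OF V(1)] a by blast
      qed
    qed
  qed
  moreover have "generated_by ?T Y \<V> (\<lambda>z. z) {x, y}"
    unfolding generated_by_def
  proof (intro conjI notI)
    show "{x, y} \<subseteq> topspace ?T"
      using C topC by simp
    assume "\<exists>A. closedin ?T A \<and> connectedin ?T A \<and> A \<subset> topspace ?T \<and> {x, y} \<subseteq> A \<and>
          (\<forall>U\<in>etale_charts ?T Y \<V> (\<lambda>z. z). \<forall>(V, K)\<in>\<V>.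
             maps_onto_convex ?T Y (\<lambda>z. z) U (V, K) \<longrightarrow> convex_under K ((\<lambda>z. z) ` (U \<inter> A)))"
    then obtain A where A: "closedin ?T A" "connectedin ?T A" "A \<subset> topspace ?T" "{x, y} \<subseteq> A"
      and cv: "\<forall>U\<in>etale_charts ?T Y \<V> (\<lambda>z. z). \<forall>(V, K)\<in>\<V>.
             maps_onto_convex ?T Y (\<lambda>z. z) U (V, K) \<longrightarrow> convex_under K ((\<lambda>z. z) ` (U \<inter> A))"
      by (elim exE conjE)
    have AC: "A \<subset> C"
      using A(3) topC by simp
    \<comment> \<open>Testing \<open>A\<close> on the etale chart \<open>C \<inter> V\<close> is
      enough, because \<open>A\<close> lies in \<open>C\<close>.\<close>
    have "convex_under K (A \<inter> V)" if V: "(V, K) \<in> \<V>" for V K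
    proof -
      have "convex_under K ((\<lambda>z. z) ` (C \<inter> V \<inter> A))"
        using bspec[OF bspec[OF cv chart(3)[OF V]] V] chart(2)[OF V] by simp
      moreover have "C \<inter> V \<inter> A = A \<inter> V"
        using AC by blast
      ultimately show ?thesis
        by simp
    qed
    then have "locally_convex_set Y \<V> A"
      unfolding locally_convex_set_def using AC CY by auto
    then have "A = C"
      using A AC closedin_trans_full[OF A(1) clC] by (intro min) (auto simp: connectedin_subtopology)
    then show False
      using AC by simp
  qed
  moreover have "compact_space ?T" "Hausdorff_space ?T"
    using C(1) H by (simp_all add: compactin_subspace Hausdorff_space_subtopology)
  ultimately show ?thesis
    using CY by (simp add: simple_geodesic_def geodesic_def)
qed

text \<open>This is (G2) for the inclusion of \<open>C\<close>, whose domain is a space on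
  \<open>'a\<close> itself; hence the form of (G2) for arbitrary types is used.\<close>

lemma simple_geodesic_irreducible:
  assumes Y: "geodesic_manifold Y \<V>" and C: "simple_geodesic Y \<V> x y C"
  shows "irreducible_between (subtopology Y C) x y"
proof -
  have geo: "geodesic (subtopology Y C) Y \<V> (\<lambda>z. z) x y"
    using C by (simp add: simple_geodesic_def)
  then have "connected_space (subtopology Y C)" "{x, y} \<subseteq> topspace (subtopology Y C)"
    unfolding geodesic_def etale_def generated_by_def by blast+
  then show ?thesis
    unfolding irreducible_between_def using geodesic_manifold_G2[OF Y geo] by auto
qed

lemma simple_arcs_connectedin: "A \<in> simple_arcs Y x y \<Longrightarrow> connectedin Y A"
  unfolding simple_arcs_def connectedin_def linear_continuum_on_def by auto

lemma simple_geodesic_imp_simple_arc: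
  assumes Y: "geodesic_manifold Y \<V>" and C: "simple_geodesic Y \<V> x y C"
  shows "C \<in> simple_arcs Y x y"
proof -
  have CY: "C \<subseteq> topspace Y" and cpt: "compact_space (subtopology Y C)"
    and H: "Hausdorff_space (subtopology Y C)"
    using C by (auto simp: simple_geodesic_def geodesic_def)
  have topC: "topspace (subtopology Y C) = C"
    using CY by auto
  note irr = simple_geodesic_irreducible[OF Y C]
  have "x \<in> C" "y \<in> C"
    using irr topC by (auto simp: irreducible_between_def)
  then show ?thesis
    using linear_continuum_irreducible_between[OF cpt H irr] CY unfolding simple_arcs_def topC by simp
qed

text \<open>\<open>C\<close> is its own closed convex hull, so a straightening \<open>A\<close> is a
  connected subset of \<open>C\<close> through both end points, and irreducibility forces equality.
  This yields both the minimality of \<open>C\<close> and, in the converse, the identification of a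
  minimal arc with \<open>C\<close>.\<close>

lemma convex_geodesic_straightening:
  assumes Y: "geodesic_manifold Y \<V>" and C: "locally_convex_set Y \<V> C" "simple_geodesic Y \<V> x y C"
    and A: "A \<in> simple_arcs Y x y"
  shows "straightening Y \<V> A C \<longleftrightarrow> A = C"
proof
  assume st: "straightening Y \<V> A C"
  have "compactin Y C"
    using C(2) by (auto simp: simple_geodesic_def geodesic_def compactin_subspace)
  then have "closedin Y C"
    using Y compactin_imp_closedin by (auto simp: geodesic_manifold_def)
  then have "Y closure_of convex_hull_in Y \<V> C = C"
    using C(1) by (simp add: convex_hull_in_def hull_same closure_of_closedin)
  moreover have "A \<subseteq> Y closure_of convex_hull_in Y \<V> A"
  proof -
    have AY: "A \<subseteq> topspace Y"
      using A by (simp add: simple_arcs_def)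
    have "local_convexity_structure Y \<V>"
      using Y by (simp add: geodesic_manifold_def)
    then have "convex_hull_in Y \<V> A \<subseteq> Y closure_of convex_hull_in Y \<V> A"
      by (intro closure_of_subset locally_convex_set_subset[OF locally_convex_set_hull] AY)
    then show ?thesis
      unfolding convex_hull_in_def using hull_subset by (rule subset_trans[rotated])
  qed
  ultimately have AC: "A \<subseteq> C"
    using st by (auto simp: straightening_def)
  have "connectedin (subtopology Y C) A"
    using simple_arcs_connectedin[OF A] AC by (simp add: connectedin_subtopology)
  moreover have "x \<in> A" "y \<in> A"
    using A by (auto simp: simple_arcs_def)
  ultimately have "A = topspace (subtopology Y C)"
    using simple_geodesic_irreducible[OF Y C(2)] unfolding irreducible_between_def by blast
  then show "A = C"
    using C(2) by (auto simp: simple_geodesic_def)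
qed (simp add: straightening_def)

lemma straighten_to_convex_geodesic:
  assumes Y: "geodesic_manifold Y \<V>" and A: "A \<in> simple_arcs Y x y"
  obtains C where "locally_convex_set Y \<V> C" "simple_geodesic Y \<V> x y C" "straightening Y \<V> C A"
proof -
  have H: "Hausdorff_space Y" and Y': "local_convexity_structure Y \<V>"
    using Y by (auto simp: geodesic_manifold_def)
  have AY: "A \<subseteq> topspace Y" and xy: "x \<in> A" "y \<in> A"
    using A by (auto simp: simple_arcs_def)
  obtain F P where FP: "finite F" "F \<subseteq> A" "connectedin Y P" "x \<in> P" "y \<in> P" "P \<subseteq> convex_hull_in Y \<V> F"
    using polygonal_connection[OF Y' simple_arcs_connectedin[OF A] xy] by blast
  let ?D = "Y closure_of convex_hull_in Y \<V> F"
  have FY: "F \<subseteq> topspace Y"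
    using FP AY by blast
  have lcF: "locally_convex_set Y \<V> (convex_hull_in Y \<V> F)"
    by (rule locally_convex_set_hull[OF Y' FY])
  have "convex_hull_in Y \<V> F \<subseteq> ?D"
    by (rule closure_of_subset[OF locally_convex_set_subset[OF lcF]])
  with FP(6) have PD: "P \<subseteq> ?D"
    by (rule subset_trans)
  have cptD: "compactin Y ?D"
    using Y FP(1) FY unfolding geodesic_manifold_def by meson
  have lcD: "locally_convex_set Y \<V> ?D"
    by (rule locally_convex_set_closure_of[OF Y' lcF])
  obtain C where C: "C \<subseteq> ?D" "compactin Y C" "connectedin Y C" "locally_convex_set Y \<V> C" "{x, y} \<subseteq> C"
    "\<And>B. closedin Y B \<Longrightarrow> connectedin Y B \<Longrightarrow> locally_convex_set Y \<V> B \<Longrightarrow> {x, y} \<subseteq> B \<Longrightarrow> B \<subseteq> C \<Longrightarrow> B = C"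
    by (rule exists_minimal_convex_continuum[OF H Y' cptD lcD FP(3) PD, of "{x, y}"]) (use FP(4,5) in auto)
  have "simple_geodesic Y \<V> x y C"
    by (rule simple_geodesic_of_minimal[OF H Y' C(2,3,4)]) (use C(5,6) in auto)
  \<comment> \<open>\<open>C\<close> is closed and convex, and \<open>F \<subseteq> A\<close> puts
    the compact set around it into the closed hull of \<open>A\<close>.\<close>
  moreover have "straightening Y \<V> C A"
  proof -
    have "Y closure_of convex_hull_in Y \<V> C = C"
      using C(4) compactin_imp_closedin[OF H C(2)]
      by (simp add: convex_hull_in_def hull_same closure_of_closedin)
    moreover have "?D \<subseteq> Y closure_of convex_hull_in Y \<V> A"
      unfolding convex_hull_in_def by (intro closure_of_mono hull_mono FP(2))
    ultimately show ?thesis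
      using C(1) by (simp add: straightening_def)
  qed
  ultimately show thesis
    using that C(4) by blast
qed

theorem theorem1:
  fixes Y :: "'a topology" and \<V> :: "'a chart set" and x y :: 'a
  assumes "geodesic_manifold Y \<V>" and "x \<in> topspace Y" and "y \<in> topspace Y"
  shows "(\<forall>A\<in>simple_arcs Y x y. \<exists>C. minimal_arc Y \<V> x y C \<and> straightening Y \<V> C A) \<and>
    (\<forall>A\<in>simple_arcs Y x y.
       minimal_arc Y \<V> x y A \<longleftrightarrow>
       locally_convex_set Y \<V> A \<and> simple_geodesic Y \<V> x y A)"
proof -
  note Y = assms(1)
  have minimal: "minimal_arc Y \<V> x y C"
    if "locally_convex_set Y \<V> C" "simple_geodesic Y \<V> x y C" for C
    unfolding minimal_arc_def
    using convex_geodesic_straightening[OF Y that] simple_geodesic_imp_simple_arc[OF Y that(2)] by auto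
  have "\<exists>C. minimal_arc Y \<V> x y C \<and> straightening Y \<V> C A" if "A \<in> simple_arcs Y x y" for A
    using straighten_to_convex_geodesic[OF Y that] minimal by metis
  \<comment> \<open>A minimal arc \<open>A\<close> is compared with a convex geodesic
    \<open>C\<close> that straightens it: by minimality \<open>A\<close> also straightens
    \<open>C\<close>, and this is possible only for \<open>A = C\<close>.\<close>
  moreover have "locally_convex_set Y \<V> A \<and> simple_geodesic Y \<V> x y A"
    if A: "A \<in> simple_arcs Y x y" and min: "minimal_arc Y \<V> x y A" for A
  proof -
    obtain C where C: "locally_convex_set Y \<V> C" "simple_geodesic Y \<V> x y C" "straightening Y \<V> C A"
      using straighten_to_convex_geodesic[OF Y A] by metis
    have "straightening Y \<V> A C"
      using min C(3) simple_geodesic_imp_simple_arc[OF Y C(2)] unfolding minimal_arc_def by blast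
    then have "A = C"
      using convex_geodesic_straightening[OF Y C(1,2) A] by simp
    then show ?thesis
      using C by simp
  qed
  ultimately show ?thesis
    using minimal by metis
qed

end
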